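(* Let $\Omega$ be the unit ball $\mathbb{B}_2$ of $\mathbb{C}^2$ or the bidisc $\mathbb{D}^2$, and let $1<p<\infty$. There is a sequence $S$ of distinct points of $\Omega$ such that the sequence $\{k_{a,p}\}_{a\in S}$ of normalized reproducing kernels in $H^p(\Omega)$ is $p$-hilbertian but is not a $p$-Riesz sequence.
   Context: $p'$ is the conjugate exponent of $p$. $H^p(\Omega)$ is the Hardy space of holomorphic $f$ on $\Omega$ with $\|f\|_p^p:=\sup_{r<1}\int|f(r\zeta)|^p\,d\sigma(\zeta)<\infty$, where $\sigma$ is normalized Lebesgue measure on $\mathbb{T}^2$ (for $\mathbb{D}^2$) or on $\partial\mathbb{B}_2$ (for $\mathbb{B}_2$). The reproducing kernel of $a\in\Omega$ is $k_a(z)=(1-\bar a_1z_1)^{-1}(1-\bar a_2z_2)^{-1}$ for $\mathbb{D}^2$ and $k_a(z)=(1-\bar a_1z_1-\bar a_2z_2)^{-2}$ for $\mathbb{B}_2$. The normalized kernel is $k_{a,p}=\big((1-|a_1|^2)(1-|a_2|^2)\big)^{1/p'}k_a$ for $\mathbb{D}^2$, and $k_{a,p}=k_a/\|k_a\|_p$ for $\mathbb{B}_2$. A sequence $\{e_a\}_{a\in S}$ in a Banach space is $p$-hilbertian if there is $C>0$ with $\|\sum_a\lambda_ae_a\|\le C\|\lambda\|_{\ell^p(S)}$ for all $\lambda\in\ell^p(S)$; $p$-besselian if there is $c>0$ with $\|\sum_a\lambda_ae_a\|\ge c\|\lambda\|_{\ell^p(S)}$ for all (finitely supported) $\lambda\in\ell^p(S)$;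 and a $p$-Riesz sequence if it is both $p$-hilbertian and $p$-besselian. *)

theory Defs
  imports "HOL-Analysis.Analysis"
begin

text \<open>
  \<open>\<complex>\<^sup>2\<close> is \<open>complex \<times> complex\<close>; the norm of the product type is the Euclidean one.
\<close>

type_synonym C2 = "complex \<times> complex"

datatype domain2 = Unit_Ball | Bidisc

fun region :: "domain2 \<Rightarrow> C2 set" where
  "region Unit_Ball = ball 0 1"
| "region Bidisc = ball 0 1 \<times> ball 0 1"

text \<open>
  The normalized Lebesgue measure on the torus is the product of two copies of normalized
  arc length.  The one on the unit sphere is given by polar coordinates (cone measure): the
  measure of \<open>A\<close> is the proportion of the volume of the ball taken up by the cone over \<open>A\<close>
  with apex 0.  Both are realized as Borel measures on all of \<open>\<complex>\<^sup>2\<close> that vanish off the torus,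
  respectively the sphere.
\<close>

definition circle_measure :: "complex measure" where
  "circle_measure = distr (uniform_measure lborel {0..2 * pi}) borel cis"

fun sigma_bd :: "domain2 \<Rightarrow> C2 measure" where
  "sigma_bd Unit_Ball = distr (uniform_measure lborel (ball 0 1)) borel (\<lambda>z. z /\<^sub>R norm z)"
| "sigma_bd Bidisc = circle_measure \<Otimes>\<^sub>M circle_measure"

definition holomorphic2_on :: "(C2 \<Rightarrow> complex) \<Rightarrow> C2 set \<Rightarrow> bool" where
  "holomorphic2_on f U \<longleftrightarrow>
     (\<forall>z\<in>U. \<exists>A B. (f has_derivative (\<lambda>h. A * fst h + B * snd h)) (at z))"

definition hardy_mean :: "domain2 \<Rightarrow> real \<Rightarrow> (C2 \<Rightarrow> complex) \<Rightarrow> ennreal" where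
  "hardy_mean \<Omega> p f =
     (SUP r\<in>{0..<1::real}. \<integral>\<^sup>+ \<zeta>. ennreal (norm (f (r *\<^sub>R \<zeta>)) powr p) \<partial>sigma_bd \<Omega>)"

text \<open>
  Elements of \<open>H\<^sup>p\<close> are represented by functions on all of \<open>\<complex>\<^sup>2\<close>; their values off the domain
  are irrelevant to membership and norm.  The real-valued norm is meaningful only on \<open>H\<^sup>p\<close>.
\<close>

definition hardy_space :: "domain2 \<Rightarrow> real \<Rightarrow> (C2 \<Rightarrow> complex) set" where
  "hardy_space \<Omega> p = {f. holomorphic2_on f (region \<Omega>) \<and> hardy_mean \<Omega> p f < \<infinity>}"

definition hardy_norm :: "domain2 \<Rightarrow> real \<Rightarrow> (C2 \<Rightarrow> complex) \<Rightarrow> real" where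
  "hardy_norm \<Omega> p f = enn2real (hardy_mean \<Omega> p f) powr (1 / p)"

fun kernel :: "domain2 \<Rightarrow> C2 \<Rightarrow> C2 \<Rightarrow> complex" where
  "kernel Unit_Ball a z = 1 / (1 - cnj (fst a) * fst z - cnj (snd a) * snd z)\<^sup>2"
| "kernel Bidisc a z = 1 / ((1 - cnj (fst a) * fst z) * (1 - cnj (snd a) * snd z))"

definition conj_exponent :: "real \<Rightarrow> real" where
  "conj_exponent p = p / (p - 1)"

fun normalized_kernel :: "domain2 \<Rightarrow> real \<Rightarrow> C2 \<Rightarrow> C2 \<Rightarrow> complex" where
  "normalized_kernel Unit_Ball p a z =
     kernel Unit_Ball a z / of_real (hardy_norm Unit_Ball p (kernel Unit_Ball a))"
| "normalized_kernel Bidisc p a z =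
     of_real (((1 - (norm (fst a))\<^sup>2) * (1 - (norm (snd a))\<^sup>2)) powr (1 / conj_exponent p))
       * kernel Bidisc a z"

definition lp_space :: "real \<Rightarrow> 'i set \<Rightarrow> ('i \<Rightarrow> complex) set" where
  "lp_space p S = {c. (\<lambda>a. norm (c a) powr p) summable_on S}"

definition lp_norm :: "real \<Rightarrow> 'i set \<Rightarrow> ('i \<Rightarrow> complex) \<Rightarrow> real" where
  "lp_norm p S c = (\<Sum>\<^sub>\<infinity>a\<in>S. norm (c a) powr p) powr (1 / p)"

text \<open>
  Below, \<open>V\<close> is the carrier and \<open>N\<close> the norm of a Banach space of complex-valued functions, and
  \<open>e a \<in> V\<close> for all \<open>a \<in> S\<close> is a standing assumption.  Infinite sums are unconditional,
  i.e. norm limits over the net of finite subsets of the index set.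
\<close>

definition has_sum_in ::
  "('b \<Rightarrow> complex) set \<Rightarrow> (('b \<Rightarrow> complex) \<Rightarrow> real) \<Rightarrow> ('i \<Rightarrow> 'b \<Rightarrow> complex) \<Rightarrow> 'i set \<Rightarrow>
     ('b \<Rightarrow> complex) \<Rightarrow> bool" where
  "has_sum_in V N e S f \<longleftrightarrow> f \<in> V \<and>
     ((\<lambda>F. N (\<lambda>z. (\<Sum>a\<in>F. e a z) - f z)) \<longlongrightarrow> 0) (finite_subsets_at_top S)"

definition p_hilbertian ::
  "('b \<Rightarrow> complex) set \<Rightarrow> (('b \<Rightarrow> complex) \<Rightarrow> real) \<Rightarrow> real \<Rightarrow> 'i set \<Rightarrow> ('i \<Rightarrow> 'b \<Rightarrow> complex) \<Rightarrow> bool"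
  where
  "p_hilbertian V N p S e \<longleftrightarrow>
     (\<exists>C>0. \<forall>c\<in>lp_space p S. \<exists>f. has_sum_in V N (\<lambda>a z. c a * e a z) S f \<and> N f \<le> C * lp_norm p S c)"

definition p_besselian ::
  "(('b \<Rightarrow> complex) \<Rightarrow> real) \<Rightarrow> real \<Rightarrow> 'i set \<Rightarrow> ('i \<Rightarrow> 'b \<Rightarrow> complex) \<Rightarrow> bool"
  where
  "p_besselian N p S e \<longleftrightarrow>
     (\<exists>C>0. \<forall>c. finite {a\<in>S. c a \<noteq> 0} \<longrightarrow>
        N (\<lambda>z. \<Sum>a\<in>{a\<in>S. c a \<noteq> 0}. c a * e a z) \<ge> C * lp_norm p S c)"

definition p_riesz_sequence ::
  "('b \<Rightarrow> complex) set \<Rightarrow> (('b \<Rightarrow> complex) \<Rightarrow> real) \<Rightarrow> real \<Rightarrow> 'i set \<Rightarrow> ('i \<Rightarrow> 'b \<Rightarrow> complex) \<Rightarrow> bool"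
  where
  "p_riesz_sequence V N p S e \<longleftrightarrow> p_hilbertian V N p S e \<and> p_besselian N p S e"

end

theory Submission
  imports Defs "HOL-Complex_Analysis.Complex_Analysis"
begin

text \<open>
  For points \<open>a = (x, 0)\<close> with \<open>0 < x < 1\<close> the normalized kernel is \<open>N\<^sub>x / (1 - x z\<^sub>1)\<^sup>k\<close> with \<open>k = 2\<close> for the
  ball and \<open>k = 1\<close> for the bidisc.  Its \<open>L\<^sup>p\<close> norms on the boundary are bounded, and \<open>N\<^sub>x\<close> tends to 0
  as \<open>x\<close> tends to 1, so the mass concentrates at \<open>z\<^sub>1 = 1\<close>.  If the \<open>x\<close> approach 1 fast enough,
  the kernels live, up to summable errors, on disjoint shells around \<open>z\<^sub>1 = 1\<close> (a gliding hump), and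
  hence form a \<open>p\<close>-hilbertian sequence.  The points are chosen in pairs \<open>x\<^sub>n < y\<^sub>n\<close>; each pair shares
  a shell, which costs only a constant factor, and is so close together that a suitable combination
  of its two kernels with coefficients of norm at least 1 has norm at most \<open>1/(n+1)\<close>.  So the
  sequence is not \<open>p\<close>-besselian.
\<close>

section \<open>Kernels with one real parameter\<close>

text \<open>The Hardy norm is a supremum over dilates, so each integral estimate is made for z -> f
  (r z) with z on the boundary, uniformly in r. Dilation by r turns the parameter x into r x <= x,
  which the kernel bounds tolerate. Near-disjointness becomes a norm bound pointwise, without
  duality or Hoelder. At a given z at most one pair sits on its shell; every other kernel is so
  small that even 2^j times it stays bounded in L^p. The reciprocals of these multipliers sum to at
  most 4, so the p-th power of the sum is at most 4^p times the sum of the p-th powers of the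
  weighted terms, which can be integrated term by term. The order of choice is forced. Given the
  outer radius of a shell, the pair is taken close enough to 1 for its weights to beat the size of
  the kernels outside that cap; given the pair, whose kernels are now bounded, the inner radius is
  taken so small that the measure of the inner cap beats that bound. The domains have opposite
  difficulties: on the bidisc the weight is explicit and boundedness in L^p is an integral estimate;
  on the ball boundedness is built into the weight, and its decay needs a lower bound for a
  norm.\<close>

definition slice_exponent :: "domain2 \<Rightarrow> nat" where
  "slice_exponent \<Omega> = (case \<Omega> of Unit_Ball \<Rightarrow> 2 | Bidisc \<Rightarrow> 1)"

definition slice_kernel :: "domain2 \<Rightarrow> real \<Rightarrow> C2 \<Rightarrow> complex" where
  "slice_kernel \<Omega> x z = 1 / (1 - of_real x * fst z) ^ slice_exponent \<Omega>"

text \<open>This is the factor N of the overview. For the ball it stays implicit as the reciprocal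
  of a norm; for the bidisc the second coordinate of (x, 0) contributes a factor 1.\<close>

definition kernel_weight :: "domain2 \<Rightarrow> real \<Rightarrow> real \<Rightarrow> real" where
  "kernel_weight \<Omega> p x = (case \<Omega> of
      Unit_Ball \<Rightarrow> 1 / hardy_norm Unit_Ball p (kernel Unit_Ball (of_real x, 0))
    | Bidisc \<Rightarrow> (1 - x\<^sup>2) powr (1 / conj_exponent p))"

lemma kernel_slice: "kernel \<Omega> (of_real x, 0) = slice_kernel \<Omega> x"
  by (rule ext, cases \<Omega>) (simp_all add: slice_kernel_def slice_exponent_def)

lemma normalized_kernel_slice:
  "normalized_kernel \<Omega> p (of_real x, 0) z = of_real (kernel_weight \<Omega> p x) * slice_kernel \<Omega> x z"
  by (cases \<Omega>)
    (simp_all add: kernel_weight_def slice_kernel_def slice_exponent_def kernel_slice of_real_divide)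

lemma norm_one_minus_ge_dist:
  fixes w :: complex
  assumes "norm w \<le> 1" "0 \<le> x" "x \<le> 1"
  shows "norm (1 - of_real x * w) \<ge> 1 - x"
proof -
  have "norm (of_real x * w) \<le> x"
    using assms by (simp add: norm_mult mult_left_le)
  moreover have "norm (1::complex) - norm (of_real x * w) \<le> norm (1 - of_real x * w)"
    by (rule norm_triangle_ineq2)
  ultimately show ?thesis by simp
qed

text \<open>Write 1 - w as (1 - x w) - (1 - x) w: the last term is at most 1 - x, hence at most |1 -
  x w|. So moving w towards the origin at most halves its distance to 1, uniformly in x. This
  transfers bounds from a boundary point to all its dilates.\<close>

lemma norm_one_minus_ge_half:
  fixes w :: complex
  assumes "norm w \<le> 1" "0 \<le> x" "x \<le> 1"
  shows "norm (1 - of_real x * w) \<ge> norm (1 - w) / 2"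
proof -
  have "1 - w = (1 - of_real x * w) - of_real (1 - x) * w"
    by (simp add: algebra_simps)
  then have "norm (1 - w) \<le> norm (1 - of_real x * w) + norm (of_real (1 - x) * w)"
    by (metis norm_triangle_ineq4)
  moreover have "norm (of_real (1 - x) * w) \<le> 1 - x"
    unfolding norm_mult norm_of_real using assms by (simp add: mult_left_le)
  ultimately show ?thesis
    using norm_one_minus_ge_dist[OF assms] by linarith
qed

lemma slice_kernel_le:
  assumes "norm (fst z) \<le> 1" "0 \<le> x" "x \<le> 1" "0 < d" "d \<le> norm (1 - of_real x * fst z)"
  shows "norm (slice_kernel \<Omega> x z) \<le> (1 / d) ^ slice_exponent \<Omega>"
  unfolding slice_kernel_def norm_divide norm_power power_one_over
  using assms by (simp add: power_mono frac_le)

lemma slice_kernel_scale: "slice_kernel \<Omega> x (r *\<^sub>R z) = slice_kernel \<Omega> (r * x) z"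
  by (simp add: slice_kernel_def scaleR_conv_of_real mult.assoc mult.left_commute)

lemma slice_kernel_measurable [measurable]: "slice_kernel \<Omega> x \<in> borel_measurable borel"
proof -
  have "(\<lambda>z::C2. 1 - of_real x * fst z) \<in> borel_measurable borel"
    by (intro borel_measurable_continuous_onI continuous_intros)
  then show ?thesis unfolding slice_kernel_def by measurable
qed

lemma slice_kernel_denominator_nonzero:
  fixes w :: complex
  assumes "norm w < 1" "0 \<le> x" "x \<le> 1"
  shows "1 - of_real x * w \<noteq> 0"
proof -
  have "norm (of_real x * w) \<le> norm w"
    using assms by (simp add: norm_mult mult_left_le_one_le)
  then have "norm (of_real x * w) \<noteq> norm (1::complex)" using assms by simp
  then show ?thesis by auto
qed

section \<open>Boundary measures: total mass, support, and caps around z_1 = 1\<close>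

lemma sets_circle_measure: "sets circle_measure = sets borel"
  by (simp add: circle_measure_def)

lemma cis_measurable [measurable]: "cis \<in> borel_measurable borel"
  by (intro borel_measurable_continuous_onI continuous_on_cis continuous_on_id)

lemma emeasure_circle_measure:
  assumes "A \<in> sets borel"
  shows "emeasure circle_measure A = emeasure lborel ({0..2*pi} \<inter> cis -` A) / ennreal (2 * pi)"
proof -
  have [measurable]: "A \<in> sets borel" by fact
  have "cis -` A \<in> sets borel"
    using measurable_sets[OF cis_measurable assms] by simp
  then show ?thesis
    unfolding circle_measure_def by (subst emeasure_distr) auto
qed

lemma emeasure_circle_UNIV: "emeasure circle_measure UNIV = 1"
  by (subst emeasure_circle_measure) (auto simp: ennreal_divide_self)

lemma sigma_finite_circle: "sigma_finite_measure circle_measure"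
proof -
  have "space circle_measure = UNIV" by (simp add: circle_measure_def)
  then interpret finite_measure circle_measure
    by (intro finite_measureI) (simp add: emeasure_circle_UNIV)
  show ?thesis by unfold_locales
qed

lemma radial_measurable [measurable]:
  "(\<lambda>z::C2. z /\<^sub>R norm z) \<in> borel_measurable borel"
  by measurable

lemma sets_sigma_bd [measurable_cong]: "sets (sigma_bd \<Omega>) = sets borel"
  by (cases \<Omega>)
    (simp_all add: borel_prod[symmetric] sets_pair_measure_cong[OF sets_circle_measure sets_circle_measure])

lemma space_sigma_bd [simp]: "space (sigma_bd \<Omega>) = UNIV"
  using sets_eq_imp_space_eq[OF sets_sigma_bd] by simp

lemma emeasure_ball_C2:
  "emeasure lborel (ball (0::C2) 1) \<noteq> 0" "emeasure lborel (ball (0::C2) 1) \<noteq> \<infinity>"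
proof -
  show "emeasure lborel (ball (0::C2) 1) \<noteq> \<infinity>"
    using emeasure_lborel_ball_finite[of "0::C2" 1] by simp
  show "emeasure lborel (ball (0::C2) 1) \<noteq> 0"
    using emeasure_lborel_ball_finite[of "0::C2" 1] content_ball_pos[of 1 "0::C2"]
    by (metis enn2real_0 less_numeral_extra(1) less_numeral_extra(3) measure_def)
qed

lemma emeasure_sphere_measure:
  assumes "A \<in> sets borel"
  shows "emeasure (sigma_bd Unit_Ball) A =
    emeasure lborel (ball 0 1 \<inter> (\<lambda>z::C2. z /\<^sub>R norm z) -` A) / emeasure lborel (ball (0::C2) 1)"
proof -
  have "(\<lambda>z::C2. z /\<^sub>R norm z) -` A \<in> sets borel"
    using measurable_sets[OF radial_measurable assms] by simp
  then show ?thesis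
    using assms by simp (subst emeasure_distr; simp)
qed

lemma emeasure_sigma_bd_UNIV: "emeasure (sigma_bd \<Omega>) UNIV = 1"
proof (cases \<Omega>)
  case Unit_Ball
  then show ?thesis
    using emeasure_ball_C2 emeasure_sphere_measure[of UNIV] by (simp add: ennreal_divide_self less_top)
next
  case Bidisc
  interpret sigma_finite_measure circle_measure by (rule sigma_finite_circle)
  have "emeasure (circle_measure \<Otimes>\<^sub>M circle_measure) (UNIV \<times> UNIV) = 1"
    by (subst emeasure_pair_measure_Times) (auto simp: sets_circle_measure emeasure_circle_UNIV)
  with Bidisc show ?thesis by simp
qed

lemma emeasure_bidisc_cylinder:
  assumes "A \<in> sets borel"
  shows "emeasure (sigma_bd Bidisc) {z. fst z \<in> A} = emeasure circle_measure A"
proof -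
  interpret sigma_finite_measure circle_measure by (rule sigma_finite_circle)
  have "{z. fst z \<in> A} = A \<times> (UNIV :: complex set)" by auto
  moreover have "emeasure (circle_measure \<Otimes>\<^sub>M circle_measure) (A \<times> UNIV) = emeasure circle_measure A"
    using assms by (subst emeasure_pair_measure_Times) (auto simp: sets_circle_measure emeasure_circle_UNIV)
  ultimately show ?thesis by simp
qed

lemma norm_fst_le_borel: "{z::C2. norm (fst z) \<le> 1} \<in> sets borel"
  by (intro borel_closed closed_Collect_le continuous_intros)

text \<open>The boundary measures are defined on all of C^2, so |z_1| <= 1 holds only almost
  everywhere; the integral comparisons below use it in this form.\<close>

lemma AE_sigma_bd_fst: "AE z in sigma_bd \<Omega>. norm (fst z) \<le> 1"
proof (rule AE_I)
  show "{z \<in> space (sigma_bd \<Omega>). \<not> norm (fst z) \<le> 1} \<subseteq> {z. fst z \<in> - cball 0 1}"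
    by auto
  show "{z. fst z \<in> - cball (0::complex) 1} \<in> sets (sigma_bd \<Omega>)"
  proof -
    have "{z::C2. fst z \<in> - cball (0::complex) 1} = - {z. norm (fst z) \<le> 1}" by auto
    then show ?thesis using norm_fst_le_borel by (simp add: sets_sigma_bd)
  qed
  show "emeasure (sigma_bd \<Omega>) {z. fst z \<in> - cball (0::complex) 1} = 0"
  proof (cases \<Omega>)
    case Unit_Ball
    have "{z::C2. fst z \<in> - cball 0 1} = - {z. norm (fst z) \<le> 1}" by auto
    then have m: "{z::C2. fst z \<in> - cball 0 1} \<in> sets borel" using norm_fst_le_borel by auto
    have "norm (fst (z /\<^sub>R norm z)) \<le> 1" for z :: C2
      using norm_fst_le[of "fst z" "snd z"] by (simp add: field_simps divide_le_eq_1)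
    then have "ball 0 1 \<inter> (\<lambda>z::C2. z /\<^sub>R norm z) -` {z. fst z \<in> - cball 0 1} = {}"
      by force
    then show ?thesis using Unit_Ball m by (simp only: emeasure_sphere_measure) simp
  next
    case Bidisc
    have "{0..2*pi} \<inter> cis -` (- cball 0 1) = {}" by auto
    then show ?thesis using Bidisc emeasure_bidisc_cylinder[of "- cball 0 1"]
      by (simp add: emeasure_circle_measure)
  qed
qed

text \<open>On the ball, the part of the cone over z_1 = 1 lies in the complex line z_2 = 0, a null
  set of C^2. On the torus, cis t = 1 leaves only the two endpoints of the parameter
  interval.\<close>

lemma emeasure_sigma_bd_pole: "emeasure (sigma_bd \<Omega>) {z. fst z = 1} = 0"
proof (cases \<Omega>)
  case Unit_Ball
  have m: "{z::C2. fst z = 1} \<in> sets borel"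
    by (intro borel_closed closed_Collect_eq continuous_intros)
  have "snd z = 0" if "fst (z /\<^sub>R norm z) = 1" for z :: C2
  proof -
    have "fst z = of_real (norm z)"
      using that by (cases "z = 0") (auto simp: scaleR_conv_of_real field_simps)
    then have "(norm (fst z))\<^sup>2 = (norm z)\<^sup>2" by simp
    then show ?thesis
      by (cases z) (simp add: norm_Pair)
  qed
  then have sub: "ball 0 1 \<inter> (\<lambda>z::C2. z /\<^sub>R norm z) -` {z. fst z = 1} \<subseteq> UNIV \<times> {0}"
    by (force simp: mem_Times_iff)
  have "emeasure (lborel \<Otimes>\<^sub>M lborel) ((UNIV::complex set) \<times> {0::complex}) = 0"
    by (subst lborel.emeasure_pair_measure_Times) auto
  then have "emeasure lborel ((UNIV::complex set) \<times> {0::complex}) = 0"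
    by (simp add: lborel_prod)
  then have "emeasure lborel (ball 0 1 \<inter> (\<lambda>z::C2. z /\<^sub>R norm z) -` {z. fst z = 1}) = 0"
    using sub by (intro emeasure_eq_0[OF _ _ sub]) (auto simp: borel_prod[symmetric] intro!: pair_measureI)
  then show ?thesis using Unit_Ball m by (simp only: emeasure_sphere_measure) simp
next
  case Bidisc
  have "{0..2*pi} \<inter> cis -` {1} \<subseteq> {0, 2*pi}"
  proof
    fix t assume t: "t \<in> {0..2*pi} \<inter> cis -` {1}"
    then have "cos t = 1" by (auto simp: cis.ctr complex_eq_iff)
    then obtain n :: int where "t = of_int n * 2 * pi" by (auto simp: cos_one_2pi_int)
    moreover have "0 \<le> real_of_int n" "real_of_int n \<le> 1"
      using t calculation pi_gt_zero by (auto simp: zero_le_mult_iff not_less)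
    then have "n = 0 \<or> n = 1" by linarith
    ultimately show "t \<in> {0, 2*pi}" by auto
  qed
  then have "emeasure lborel ({0..2*pi} \<inter> cis -` {1}) = 0"
    by (rule emeasure_eq_0[rotated 2]) (auto intro: finite_imp_null_set_lborel[THEN null_setsD1])
  then have "emeasure circle_measure {1} = 0"
    by (simp add: emeasure_circle_measure)
  then show ?thesis using Bidisc emeasure_bidisc_cylinder[of "{1}"] by simp
qed

lemma cap_borel: "{z::C2. norm (1 - fst z) < d} \<in> sets borel"
  by (intro borel_open open_Collect_less continuous_intros)

text \<open>Continuity from above: caps of radius 1/(n+1) decrease to the null set z_1 = 1. Bare
  existence of a radius suffices because the inner radius of a shell is chosen after the kernels it
  has to control.\<close>

lemma emeasure_cap_small:
  assumes "0 < e"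
  shows "\<exists>d>0. emeasure (sigma_bd \<Omega>) {z. norm (1 - fst z) < d} < ennreal e"
proof -
  let ?A = "\<lambda>n. {z::C2. norm (1 - fst z) < inverse (real (Suc n))}"
  have "(\<lambda>n. emeasure (sigma_bd \<Omega>) (?A n)) \<longlonglongrightarrow> emeasure (sigma_bd \<Omega>) (\<Inter>n. ?A n)"
  proof (rule Lim_emeasure_decseq)
    show "range ?A \<subseteq> sets (sigma_bd \<Omega>)" using cap_borel by (auto simp: sets_sigma_bd)
    show "decseq ?A"
      by (intro antimonoI Collect_mono) (smt (verit) inverse_le_iff_le of_nat_0_less_iff of_nat_mono Suc_le_mono zero_less_Suc)
    have "emeasure (sigma_bd \<Omega>) (?A i) \<le> emeasure (sigma_bd \<Omega>) UNIV" for i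
      by (intro emeasure_mono) (auto simp: sets_sigma_bd)
    then show "emeasure (sigma_bd \<Omega>) (?A i) \<noteq> \<infinity>" for i
      unfolding emeasure_sigma_bd_UNIV by (metis ennreal_one_neq_top infinity_ennreal_def neq_top_trans)
  qed
  moreover have "(\<Inter>n. ?A n) = {z. fst z = 1}"
  proof -
    have "fst z = 1" if "\<forall>n. norm (1 - fst z) < inverse (real (Suc n))" for z :: C2
      using that reals_Archimedean[of "norm (1 - fst z)"] by (metis less_asym right_minus_eq zero_less_norm_iff)
    then show ?thesis by auto
  qed
  ultimately have "(\<lambda>n. emeasure (sigma_bd \<Omega>) (?A n)) \<longlonglongrightarrow> 0"
    by (simp add: emeasure_sigma_bd_pole)
  then have "eventually (\<lambda>n. emeasure (sigma_bd \<Omega>) (?A n) < ennreal e) sequentially"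
    using assms by (intro order_tendstoD(2)) auto
  then obtain n where "emeasure (sigma_bd \<Omega>) (?A n) < ennreal e"
    by (auto simp: eventually_sequentially)
  then show ?thesis by (intro exI[of _ "inverse (real (Suc n))"]) auto
qed

section \<open>Norm bounds\<close>

lemma hardy_mean_le:
  assumes "0 < p" "0 \<le> B"
    and le: "\<And>z. norm (fst z) < 1 \<Longrightarrow> norm (f z) \<le> B"
  shows "hardy_mean \<Omega> p f \<le> ennreal (B powr p)"
  unfolding hardy_mean_def
proof (rule SUP_least)
  fix r :: real assume r: "r \<in> {0..<1}"
  have "(\<integral>\<^sup>+ \<zeta>. ennreal (norm (f (r *\<^sub>R \<zeta>)) powr p) \<partial>sigma_bd \<Omega>)
      \<le> (\<integral>\<^sup>+ \<zeta>. ennreal (B powr p) \<partial>sigma_bd \<Omega>)"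
  proof (rule nn_integral_mono_AE, use AE_sigma_bd_fst in eventually_elim)
    fix \<zeta> :: C2 assume z: "norm (fst \<zeta>) \<le> 1"
    have "r * norm (fst \<zeta>) \<le> r * 1" using r z by (intro mult_left_mono) auto
    then have "norm (fst (r *\<^sub>R \<zeta>)) < 1" using r by simp
    then show "ennreal (norm (f (r *\<^sub>R \<zeta>)) powr p) \<le> ennreal (B powr p)"
      using assms by (intro ennreal_leI powr_mono2) auto
  qed
  also have "\<dots> = ennreal (B powr p)"
    using emeasure_sigma_bd_UNIV by simp
  finally show "(\<integral>\<^sup>+ \<zeta>. ennreal (norm (f (r *\<^sub>R \<zeta>)) powr p) \<partial>sigma_bd \<Omega>) \<le> ennreal (B powr p)" .
qed

lemma slice_kernel_bound:
  assumes "0 \<le> x" "x < 1" "norm (fst z) \<le> 1"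
  shows "norm (slice_kernel \<Omega> x z) \<le> (1 / (1 - x)) ^ slice_exponent \<Omega>"
  using assms by (intro slice_kernel_le norm_one_minus_ge_dist) auto

lemma hardy_mean_slice_kernel_finite:
  assumes "0 < p" "0 \<le> x" "x < 1"
  shows "hardy_mean \<Omega> p (slice_kernel \<Omega> x) < \<infinity>"
proof -
  have "hardy_mean \<Omega> p (slice_kernel \<Omega> x) \<le> ennreal (((1 / (1 - x)) ^ slice_exponent \<Omega>) powr p)"
    using assms by (intro hardy_mean_le slice_kernel_bound) auto
  then show ?thesis by (auto intro: le_less_trans)
qed

lemma hardy_norm_powr:
  assumes "0 < p" "hardy_mean \<Omega> p f < \<infinity>"
  shows "ennreal (hardy_norm \<Omega> p f powr p) = hardy_mean \<Omega> p f"
  using assms by (simp add: hardy_norm_def powr_powr less_top)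

lemma hardy_norm_le:
  assumes "0 < p" "0 \<le> B" "hardy_mean \<Omega> p f \<le> ennreal B"
  shows "hardy_norm \<Omega> p f \<le> B powr (1 / p)"
  unfolding hardy_norm_def using assms
  by (intro powr_mono2) (auto intro: enn2real_leI)

text \<open>The term r = 0 of the supremum already equals 1. Hence the normalization on the ball
  never divides by zero.\<close>

lemma hardy_mean_slice_kernel_ge_1: "hardy_mean \<Omega> p (slice_kernel \<Omega> x) \<ge> 1"
proof -
  have "(\<integral>\<^sup>+ \<zeta>. ennreal (norm (slice_kernel \<Omega> x (0 *\<^sub>R \<zeta>)) powr p) \<partial>sigma_bd \<Omega>) \<le> hardy_mean \<Omega> p (slice_kernel \<Omega> x)"
    unfolding hardy_mean_def by (rule SUP_upper) auto
  then show ?thesis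
    by (simp add: slice_kernel_def emeasure_sigma_bd_UNIV)
qed

lemma hardy_norm_slice_kernel_pos:
  assumes "0 < p" "0 \<le> x" "x < 1"
  shows "hardy_norm \<Omega> p (slice_kernel \<Omega> x) > 0"
proof -
  have "enn2real (hardy_mean \<Omega> p (slice_kernel \<Omega> x)) > 0"
    using hardy_mean_slice_kernel_finite[OF assms, of \<Omega>] hardy_mean_slice_kernel_ge_1[of \<Omega> p x]
    by (auto simp: enn2real_positive_iff less_le_trans[OF zero_less_one])
  then show ?thesis by (simp add: hardy_norm_def)
qed

lemma kernel_weight_pos:
  assumes "0 < p" "0 < x" "x < 1"
  shows "kernel_weight \<Omega> p x > 0"
proof (cases \<Omega>)
  case Unit_Ball
  then show ?thesis using hardy_norm_slice_kernel_pos[of p x Unit_Ball] assms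
    by (simp add: kernel_weight_def kernel_slice)
next
  case Bidisc
  have "x\<^sup>2 < 1" using assms by (simp add: power_less_one_iff)
  then show ?thesis using Bidisc by (simp add: kernel_weight_def)
qed

section \<open>Uniform L^p bounds for the normalized kernels\<close>

lemma half_le_sin:
  fixes u :: real
  assumes "0 \<le> u" "u \<le> pi / 2"
  shows "u / 2 \<le> sin u"
proof (cases "u \<le> pi / 3")
  case True
  have "sin 0 - 0 / 2 \<le> sin u - u / 2"
  proof (rule DERIV_nonneg_imp_nondecreasing[OF assms(1)])
    fix x assume "0 \<le> x" "x \<le> u"
    then have "cos x \<ge> cos (pi / 3)" using True by (intro cos_monotone_0_pi_le) auto
    then show "\<exists>y. ((\<lambda>u. sin u - u / 2) has_real_derivative y) (at x) \<and> 0 \<le> y"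
      by (intro exI[of _ "cos x - 1 / 2"] conjI) (auto intro!: derivative_eq_intros simp: cos_60)
  qed
  then show ?thesis by simp
next
  case False
  \<comment> \<open>Beyond pi / 3 the sine is at least sqrt 3 / 2 >= 0.85, while u / 2 <= pi / 4 <
    0.8.\<close>
  then have "sin (pi / 3) \<le> sin u" using assms by (intro sin_monotone_2pi_le) auto
  moreover have "sqrt 3 \<ge> 1.7" by (rule real_le_rsqrt) (simp add: power2_eq_square)
  moreover have "u / 2 \<le> 0.8" using assms pi_less_4 pi_approx by simp
  ultimately show ?thesis by (simp add: sin_60)
qed

lemma norm_one_minus_cis: "norm (1 - cis t) = 2 * \<bar>sin (t / 2)\<bar>"
proof -
  have "(norm (1 - cis t))\<^sup>2 = 2 - 2 * cos t"
    unfolding cmod_power2 using sin_cos_squared_add[of t] by (simp add: power2_eq_square algebra_simps)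
  also have "\<dots> = (2 * \<bar>sin (t / 2)\<bar>)\<^sup>2"
    using cos_double_sin[of "t / 2"] by (simp add: power_mult_distrib)
  finally show ?thesis by (rule power2_eq_imp_eq) auto
qed

text \<open>The left side is the average of two lower bounds: 1 - y, and |1 - cis t| / 2 = |sin
  (t/2)|, which is at least a quarter of the distance from t to the nearer end of [0, 2 pi].\<close>

lemma norm_one_minus_cis_ge:
  assumes "0 \<le> y" "y < 1" "0 \<le> t" "t \<le> 2 * pi"
  shows "(4 * (1 - y) + min t (2 * pi - t)) / 8 \<le> norm (1 - of_real y * cis t)"
proof -
  have "min t (2 * pi - t) / 2 / 2 \<le> sin (t / 2)"
  proof (cases "t \<le> pi")
    case True
    then show ?thesis using half_le_sin[of "t / 2"] assms by simp
  next
    case False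
    have "sin (pi - t / 2) = sin (t / 2)" by simp
    moreover have "(pi - t / 2) / 2 \<le> sin (pi - t / 2)"
      using False assms by (intro half_le_sin) auto
    ultimately show ?thesis using False assms by (simp add: min_def)
  qed
  moreover have "norm (1 - of_real y * cis t) \<ge> norm (1 - cis t) / 2"
    using assms by (intro norm_one_minus_ge_half) auto
  moreover have "norm (1 - of_real y * cis t) \<ge> 1 - y"
    using assms by (intro norm_one_minus_ge_dist) auto
  ultimately show ?thesis by (simp add: norm_one_minus_cis)
qed

text \<open>The two integrals are mirror images under t -> b - t. They serve the two ends of
  [0, 2 pi], both of which \<open>cis\<close> maps to the singular point 1.\<close>

lemma nn_integral_shifted_powr:
  fixes h :: real
  assumes "1 < p" "0 < h" "0 \<le> b"
  shows "(\<integral>\<^sup>+t. ennreal ((h + t) powr (- p)) * indicator {0..b} t \<partial>lborel) \<le> ennreal (h powr (1 - p) / (p - 1))"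
    and "(\<integral>\<^sup>+t. ennreal ((h + b - t) powr (- p)) * indicator {0..b} t \<partial>lborel) \<le> ennreal (h powr (1 - p) / (p - 1))"
proof -
  have "(h + b) powr (1 - p) / (1 - p) \<le> 0"
    using assms by (intro divide_nonneg_neg) auto
  moreover have "- (h powr (1 - p) / (1 - p)) = h powr (1 - p) / (p - 1)"
    by (simp add: minus_divide_right)
  ultimately have key: "(h + b) powr (1 - p) / (1 - p) - h powr (1 - p) / (1 - p) \<le> h powr (1 - p) / (p - 1)"
    by linarith
  have "(\<integral>\<^sup>+t. ennreal ((h + t) powr (- p)) * indicator {0..b} t \<partial>lborel)
      = ennreal ((h + b) powr (1 - p) / (1 - p) - (h + 0) powr (1 - p) / (1 - p))"
    using assms by (intro nn_integral_FTC_Icc) (auto intro!: derivative_eq_intros)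
  also have "\<dots> \<le> ennreal (h powr (1 - p) / (p - 1))"
    using key by (intro ennreal_leI) simp
  finally show "(\<integral>\<^sup>+t. ennreal ((h + t) powr (- p)) * indicator {0..b} t \<partial>lborel) \<le> ennreal (h powr (1 - p) / (p - 1))" .
  have "(\<integral>\<^sup>+t. ennreal ((h + b - t) powr (- p)) * indicator {0..b} t \<partial>lborel)
      = ennreal (- ((h + b - b) powr (1 - p) / (1 - p)) - - ((h + b - 0) powr (1 - p) / (1 - p)))"
    using assms by (intro nn_integral_FTC_Icc) (auto intro!: derivative_eq_intros)
  also have "\<dots> \<le> ennreal (h powr (1 - p) / (p - 1))"
    using key by (intro ennreal_leI) simp
  finally show "(\<integral>\<^sup>+t. ennreal ((h + b - t) powr (- p)) * indicator {0..b} t \<partial>lborel) \<le> ennreal (h powr (1 - p) / (p - 1))" .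
qed

lemma nn_integral_circle_kernel:
  assumes "1 < p"
  shows "\<exists>K\<ge>0. \<forall>y\<in>{0..<1}.
    (\<integral>\<^sup>+\<zeta>. ennreal (norm (1 - of_real y * \<zeta>) powr (- p)) \<partial>circle_measure) \<le> ennreal (K * (1 - y) powr (1 - p))"
\<comment> \<open>The factor 8^p comes from the denominator 8 in the pointwise bound, 2 from the two
  ends of the interval, 4^(1-p) from h = 4 (1 - y), and 2 pi from normalizing arc length.\<close>
proof (intro exI[of _ "8 powr p * (2 * 4 powr (1 - p) / (p - 1)) / (2 * pi)"] conjI ballI)
  show "0 \<le> 8 powr p * (2 * 4 powr (1 - p) / (p - 1)) / (2 * pi)" using assms by simp
  fix y :: real assume y: "y \<in> {0..<1}"
  define h where "h = 4 * (1 - y)"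
  have h: "0 < h" using y by (simp add: h_def)
  have [measurable]: "(\<lambda>t. norm (1 - of_real y * cis t) powr (- p)) \<in> borel_measurable borel"
    by measurable
  have le: "norm (1 - of_real y * cis t) powr (- p)
      \<le> 8 powr p * ((h + t) powr (- p) + (h + 2 * pi - t) powr (- p))" if t: "t \<in> {0..2*pi}" for t
  proof -
    have 1: "(h + min t (2 * pi - t)) / 8 \<le> norm (1 - of_real y * cis t)"
      using norm_one_minus_cis_ge[of y t] y t by (simp add: h_def)
    have "norm (1 - of_real y * cis t) powr (- p) \<le> ((h + min t (2 * pi - t)) / 8) powr (- p)"
      using 1 assms h t by (intro powr_mono2') auto
    also have "\<dots> = 8 powr p * (h + min t (2 * pi - t)) powr (- p)"
      using h t by (simp add: powr_divide powr_minus field_simps)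
    also have "(h + min t (2 * pi - t)) powr (- p) \<le> (h + t) powr (- p) + (h + 2 * pi - t) powr (- p)"
      by (cases "t \<le> 2 * pi - t") (auto simp: min_def algebra_simps)
    finally show ?thesis by simp
  qed
  have "(\<integral>\<^sup>+\<zeta>. ennreal (norm (1 - of_real y * \<zeta>) powr (- p)) \<partial>circle_measure)
      = (\<integral>\<^sup>+t. ennreal (norm (1 - of_real y * cis t) powr (- p)) * indicator {0..2*pi} t \<partial>lborel) / ennreal (2 * pi)"
    unfolding circle_measure_def
    by (subst nn_integral_distr, measurable, subst nn_integral_uniform_measure) auto
  also have "\<dots> \<le> ennreal (8 powr p * (2 * h powr (1 - p) / (p - 1))) / ennreal (2 * pi)"
  proof (rule divide_right_mono_ennreal)
    have "(\<integral>\<^sup>+t. ennreal (norm (1 - of_real y * cis t) powr (- p)) * indicator {0..2*pi} t \<partial>lborel)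
       \<le> (\<integral>\<^sup>+t. ennreal (8 powr p) * (ennreal ((h + t) powr (- p)) * indicator {0..2*pi} t
             + ennreal ((h + 2 * pi - t) powr (- p)) * indicator {0..2*pi} t) \<partial>lborel)"
      using le by (intro nn_integral_mono)
        (auto simp: ennreal_plus[symmetric] ennreal_mult[symmetric] simp del: ennreal_plus split: split_indicator intro!: ennreal_leI)
    also have "\<dots> = ennreal (8 powr p) * ((\<integral>\<^sup>+t. ennreal ((h + t) powr (- p)) * indicator {0..2*pi} t \<partial>lborel)
         + (\<integral>\<^sup>+t. ennreal ((h + 2 * pi - t) powr (- p)) * indicator {0..2*pi} t \<partial>lborel))"
      by (subst nn_integral_cmult, measurable, subst nn_integral_add) auto
    also have "\<dots> \<le> ennreal (8 powr p) * (ennreal (h powr (1 - p) / (p - 1)) + ennreal (h powr (1 - p) / (p - 1)))"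
      using assms h by (intro mult_left_mono add_mono nn_integral_shifted_powr) auto
    also have "\<dots> = ennreal (8 powr p * (2 * h powr (1 - p) / (p - 1)))"
      using assms by (simp add: ennreal_plus[symmetric] ennreal_mult[symmetric] del: ennreal_plus)
    finally show "(\<integral>\<^sup>+t. ennreal (norm (1 - of_real y * cis t) powr (- p)) * indicator {0..2*pi} t \<partial>lborel)
      \<le> ennreal (8 powr p * (2 * h powr (1 - p) / (p - 1)))" .
  qed
  also have "\<dots> = ennreal (8 powr p * (2 * h powr (1 - p) / (p - 1)) / (2 * pi))"
    using assms by (subst divide_ennreal) auto
  also have "8 powr p * (2 * h powr (1 - p) / (p - 1)) / (2 * pi)
      = 8 powr p * (2 * 4 powr (1 - p) / (p - 1)) / (2 * pi) * (1 - y) powr (1 - p)"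
    using powr_mult[of 4 "1 - y" "1 - p"] y by (simp only: h_def) simp
  finally show "(\<integral>\<^sup>+\<zeta>. ennreal (norm (1 - of_real y * \<zeta>) powr (- p)) \<partial>circle_measure)
     \<le> ennreal (8 powr p * (2 * 4 powr (1 - p) / (p - 1)) / (2 * pi) * (1 - y) powr (1 - p))" .
qed

lemma nn_integral_bidisc_fst:
  assumes [measurable]: "f \<in> borel_measurable borel"
  shows "(\<integral>\<^sup>+z. f (fst z) \<partial>sigma_bd Bidisc) = (\<integral>\<^sup>+\<zeta>. f \<zeta> \<partial>circle_measure)"
proof -
  interpret sigma_finite_measure circle_measure by (rule sigma_finite_circle)
  have [measurable_cong]: "sets circle_measure = sets borel" by (rule sets_circle_measure)
  have "(\<integral>\<^sup>+z. f (fst z) \<partial>sigma_bd Bidisc) = (\<integral>\<^sup>+x. (\<integral>\<^sup>+y. f (fst (x, y)) \<partial>circle_measure) \<partial>circle_measure)"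
    unfolding sigma_bd.simps by (subst nn_integral_fst[symmetric]) auto
  moreover have "emeasure circle_measure (space circle_measure) = 1"
    using emeasure_circle_UNIV by (simp add: circle_measure_def)
  ultimately show ?thesis by simp
qed

text \<open>On the ball each kernel has norm 1, so M = 1 works. On the bidisc the p-th power of the
  weight is (1 - x^2)^(p-1), because p / p' = p - 1, and this cancels the growth (1 - r x)^(1-p) of
  the circle integral. The bound is stated for each fixed r since the later estimates work at fixed
  r.\<close>

lemma normalized_slice_kernel_bounded:
  assumes "1 < p"
  shows "\<exists>M\<ge>0. \<forall>x\<in>{0<..<1}. \<forall>r\<in>{0..<1}.
    (\<integral>\<^sup>+z. ennreal ((kernel_weight \<Omega> p x * norm (slice_kernel \<Omega> x (r *\<^sub>R z))) powr p) \<partial>sigma_bd \<Omega>) \<le> ennreal M"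
proof (cases \<Omega>)
  case Unit_Ball
  have "(\<integral>\<^sup>+z. ennreal ((kernel_weight \<Omega> p x * norm (slice_kernel \<Omega> x (r *\<^sub>R z))) powr p) \<partial>sigma_bd \<Omega>) \<le> ennreal 1"
    if x: "x \<in> {0<..<1}" and r: "r \<in> {0..<1}" for x r
  proof -
    define N where "N = hardy_norm \<Omega> p (slice_kernel \<Omega> x)"
    have N: "N > 0" unfolding N_def using x assms by (intro hardy_norm_slice_kernel_pos) auto
    have w: "kernel_weight \<Omega> p x = 1 / N"
      using Unit_Ball by (simp add: kernel_weight_def N_def kernel_slice)
    have "(\<integral>\<^sup>+z. ennreal ((kernel_weight \<Omega> p x * norm (slice_kernel \<Omega> x (r *\<^sub>R z))) powr p) \<partial>sigma_bd \<Omega>)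
      = (\<integral>\<^sup>+z. ennreal ((1 / N) powr p) * ennreal (norm (slice_kernel \<Omega> x (r *\<^sub>R z)) powr p) \<partial>sigma_bd \<Omega>)"
      unfolding w using N by (intro nn_integral_cong) (simp add: powr_mult powr_divide ennreal_mult[symmetric])
    also have "\<dots> = ennreal ((1 / N) powr p) * (\<integral>\<^sup>+z. ennreal (norm (slice_kernel \<Omega> x (r *\<^sub>R z)) powr p) \<partial>sigma_bd \<Omega>)"
      unfolding slice_kernel_scale by (rule nn_integral_cmult) measurable
    also have "\<dots> \<le> ennreal ((1 / N) powr p) * hardy_mean \<Omega> p (slice_kernel \<Omega> x)"
      unfolding hardy_mean_def using r by (intro mult_left_mono SUP_upper) auto
    also have "\<dots> = ennreal ((1 / N) powr p) * ennreal (N powr p)"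
      unfolding N_def using x assms
      by (subst hardy_norm_powr) (auto intro: hardy_mean_slice_kernel_finite[unfolded infinity_ennreal_def])
    also have "\<dots> = ennreal 1"
      using N by (simp add: ennreal_mult[symmetric] powr_mult[symmetric] del: ennreal_1)
    finally show ?thesis .
  qed
  then show ?thesis by (intro exI[of _ 1]) auto
next
  case Bidisc
  obtain K where K: "K \<ge> 0" and le: "\<And>y. y \<in> {0..<1} \<Longrightarrow>
      (\<integral>\<^sup>+\<zeta>. ennreal (norm (1 - of_real y * \<zeta>) powr (- p)) \<partial>circle_measure) \<le> ennreal (K * (1 - y) powr (1 - p))"
    using nn_integral_circle_kernel[OF assms] by blast
  have "(\<integral>\<^sup>+z. ennreal ((kernel_weight \<Omega> p x * norm (slice_kernel \<Omega> x (r *\<^sub>R z))) powr p) \<partial>sigma_bd \<Omega>)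
      \<le> ennreal (2 powr (p - 1) * K)"
    if x: "x \<in> {0<..<1}" and r: "r \<in> {0..<1}" for x r
  proof -
    have x2: "x\<^sup>2 < 1" using x by (simp add: power_less_one_iff)
    have rx': "r * x \<le> x"
      using x r by (intro mult_left_le_one_le) auto
    then have "r * x < 1" using x by (simp only: greaterThanLessThan_iff) linarith
    with rx' have rx: "r * x \<in> {0..<1}" "r * x \<le> x"
      using x r by auto
    have "1 / conj_exponent p * p = p - 1" using assms by (simp add: conj_exponent_def)
    then have w: "kernel_weight \<Omega> p x powr p = (1 - x\<^sup>2) powr (p - 1)"
      using Bidisc by (simp add: kernel_weight_def powr_powr)
    have "(\<integral>\<^sup>+z. ennreal ((kernel_weight \<Omega> p x * norm (slice_kernel \<Omega> x (r *\<^sub>R z))) powr p) \<partial>sigma_bd \<Omega>)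
      = (\<integral>\<^sup>+z. ennreal ((1 - x\<^sup>2) powr (p - 1) * norm (1 - of_real (r * x) * fst z) powr (- p)) \<partial>sigma_bd Bidisc)"
      unfolding Bidisc[symmetric]
    proof (intro nn_integral_cong arg_cong[of _ _ ennreal])
      fix z :: C2
      show "(kernel_weight \<Omega> p x * norm (slice_kernel \<Omega> x (r *\<^sub>R z))) powr p
        = (1 - x\<^sup>2) powr (p - 1) * norm (1 - of_real (r * x) * fst z) powr (- p)"
        unfolding slice_kernel_scale w[symmetric] using Bidisc kernel_weight_pos[of p x \<Omega>] assms x
        by (simp add: powr_mult slice_kernel_def slice_exponent_def norm_divide powr_divide powr_minus_divide)
    qed
    also have "\<dots> = (\<integral>\<^sup>+\<zeta>. ennreal ((1 - x\<^sup>2) powr (p - 1) * norm (1 - of_real (r * x) * \<zeta>) powr (- p)) \<partial>circle_measure)"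
      by (rule nn_integral_bidisc_fst) measurable
    also have "\<dots> = ennreal ((1 - x\<^sup>2) powr (p - 1)) * (\<integral>\<^sup>+\<zeta>. ennreal (norm (1 - of_real (r * x) * \<zeta>) powr (- p)) \<partial>circle_measure)"
      unfolding ennreal_mult'[OF powr_ge_zero]
      by (rule nn_integral_cmult) (measurable, simp_all add: sets_circle_measure cong: measurable_cong_sets)
    also have "\<dots> \<le> ennreal ((1 - x\<^sup>2) powr (p - 1)) * ennreal (K * (1 - r * x) powr (1 - p))"
      using le[OF rx(1)] by (intro mult_left_mono) auto
    also have "\<dots> = ennreal ((1 - x\<^sup>2) powr (p - 1) * (K * (1 - r * x) powr (1 - p)))"
      using K by (simp add: ennreal_mult)
    also have "\<dots> \<le> ennreal (2 powr (p - 1) * K)"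
    proof (rule ennreal_leI)
      have "(1 - r * x) powr (1 - p) \<le> (1 - x) powr (1 - p)"
        using rx x assms by (intro powr_mono2') auto
      moreover have "(1 - x\<^sup>2) powr (p - 1) = (1 + x) powr (p - 1) * (1 - x) powr (p - 1)"
        using x by (subst powr_mult[symmetric]) (auto simp: power2_eq_square algebra_simps)
      moreover have "(1 + x) powr (p - 1) \<le> 2 powr (p - 1)"
        using x assms by (intro powr_mono2) auto
      then have "(1 + x) powr (p - 1) * (1 - x) powr (p - 1) \<le> 2 powr (p - 1) * (1 - x) powr (p - 1)"
        by (rule mult_right_mono) simp
      ultimately have "(1 - x\<^sup>2) powr (p - 1) * (K * (1 - r * x) powr (1 - p))
          \<le> (2 powr (p - 1) * (1 - x) powr (p - 1)) * (K * (1 - x) powr (1 - p))"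
        using K by (intro mult_mono) auto
      also have "\<dots> = 2 powr (p - 1) * K * ((1 - x) powr (p - 1) * (1 - x) powr (1 - p))"
        by simp
      also have "(1 - x) powr (p - 1) * (1 - x) powr (1 - p) = 1"
        using x by (simp add: powr_add[symmetric])
      finally show "(1 - x\<^sup>2) powr (p - 1) * (K * (1 - r * x) powr (1 - p)) \<le> 2 powr (p - 1) * K" by simp
    qed
    finally show ?thesis .
  qed
  then show ?thesis using K by (intro exI[of _ "2 powr (p - 1) * K"]) auto
qed

section \<open>Decay of the normalizing constants\<close>

lemma emeasure_complex_box:
  assumes "a \<le> b" "c \<le> d"
  shows "emeasure lborel (box (Complex a c) (Complex b d)) = ennreal ((b - a) * (d - c))"
  using assms by (subst emeasure_lborel_box) (auto simp: Basis_complex_def inner_complex_def)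

text \<open>The cap has extent \<open>d\<close> in the imaginary part of \<open>z\<^sub>1\<close> and \<open>sqrt d\<close> in the two real directions of \<open>z\<^sub>2\<close>.\<close>

lemma emeasure_sphere_cap_ge:
  "\<exists>c>0. \<forall>d\<in>{0<..1}. ennreal (c * d\<^sup>2) \<le> emeasure (sigma_bd Unit_Ball) {z. norm (1 - fst z) < d}"
proof -
  define V where "V = measure lborel (ball (0::C2) 1)"
  have V: "V > 0" by (simp add: V_def content_ball_pos)
  have eV: "emeasure lborel (ball (0::C2) 1) = ennreal V"
    using emeasure_ball_C2 by (simp add: V_def emeasure_eq_ennreal_measure)
  have "ennreal (1 / 64 / V * d\<^sup>2) \<le> emeasure (sigma_bd Unit_Ball) {z. norm (1 - fst z) < d}"
    if d: "d \<in> {0<..1}" for d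
  proof -
    define s where "s = sqrt d / 4"
    have s: "s > 0" "s\<^sup>2 = d / 16" using d by (auto simp: s_def power_divide)
    \<comment> \<open>A box inside the cone over the cap, of volume (1/4) (d/4) (2 s)^2 = d^2 / 64.
      Keeping Re z_1 between 1/2 and 3/4 keeps the box inside the ball and away from the apex, where
      the radial projection is singular.\<close>
    define B :: "C2 set" where "B = box (Complex (1/2) (- (d/8))) (Complex (3/4) (d/8)) \<times> box (Complex (- s) (- s)) (Complex s s)"
    have "emeasure lborel B = emeasure (lborel \<Otimes>\<^sub>M lborel) B"
      by (simp add: lborel_prod)
    also have "\<dots> = ennreal (1/4 * (d/4)) * ennreal ((2 * s) * (2 * s))"
      unfolding B_def using d s
      by (subst lborel.emeasure_pair_measure_Times) (auto simp: emeasure_complex_box)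
    also have "\<dots> = ennreal (d\<^sup>2 / 64)"
      using d s by (simp add: ennreal_mult[symmetric] power2_eq_square)
    finally have eB: "emeasure lborel B = ennreal (d\<^sup>2 / 64)" .
    have "z \<in> ball 0 1 \<and> norm (1 - fst (z /\<^sub>R norm z)) < d" if "z \<in> B" for z
    proof -
      obtain a b where z: "z = (a, b)" by (cases z)
      have a: "1/2 < Re a" "Re a < 3/4" "\<bar>Im a\<bar> < d/8"
        and b: "\<bar>Re b\<bar> < s" "\<bar>Im b\<bar> < s"
        using that by (auto simp: z B_def mem_box Basis_complex_def inner_complex_def)
      have nz2: "(norm z)\<^sup>2 = (Re a)\<^sup>2 + ((Im a)\<^sup>2 + (Re b)\<^sup>2 + (Im b)\<^sup>2)"
        by (simp add: z norm_Pair cmod_power2)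
      have sq: "u\<^sup>2 < v\<^sup>2" if "\<bar>u\<bar> < v" for u v :: real
        using power_strict_mono[of "\<bar>u\<bar>" v 2] that by simp
      have q: "(Im a)\<^sup>2 < (d/8)\<^sup>2" "(Re b)\<^sup>2 < s\<^sup>2" "(Im b)\<^sup>2 < s\<^sup>2" "(Re a)\<^sup>2 < (3/4)\<^sup>2"
        using a b by (auto intro!: sq)
      have dd: "d\<^sup>2 \<le> d" using d by (simp add: power2_eq_square mult_left_le)
      have e: "(Im a)\<^sup>2 + (Re b)\<^sup>2 + (Im b)\<^sup>2 < d / 64 + d / 8"
        using q dd unfolding s(2) by (simp add: power_divide)
      then have "(norm z)\<^sup>2 < 1\<^sup>2" unfolding nz2 using q(4) d by (simp add: power_divide)
      then have n1: "norm z < 1" by (rule power2_less_imp_less) simp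
      have "(Re a)\<^sup>2 \<le> (norm z)\<^sup>2" unfolding nz2 by simp
      then have nR: "Re a \<le> norm z" by (rule power2_le_imp_le) simp
      have n: "norm z > 1/2" using nR a by linarith
      \<comment> \<open>Since norm z + Re a exceeds 1, the gap norm z - Re a is bounded by the
        difference of squares, which is of order d because the sides in z_2 have length of order
        sqrt d.\<close>
      have "(norm z - Re a) * 1 \<le> (norm z - Re a) * (norm z + Re a)"
        using nR n a by (intro mult_left_mono) auto
      also have "\<dots> = (norm z)\<^sup>2 - (Re a)\<^sup>2" by (simp add: power2_eq_square algebra_simps)
      also have "\<dots> < d / 64 + d / 8" using e unfolding nz2 by simp
      finally have r: "norm z - Re a < d / 64 + d / 8" by simp
      have "1 - fst (z /\<^sub>R norm z) = (of_real (norm z) - a) /\<^sub>R norm z"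
      proof -
        have "complex_of_real (norm z) \<noteq> 0" using n by auto
        moreover have "fst z = a" by (simp add: z)
        ultimately show ?thesis by (simp add: scaleR_conv_of_real field_simps)
      qed
      then have "norm (1 - fst (z /\<^sub>R norm z)) = norm (of_real (norm z) - a) / norm z"
        by (simp only: norm_scaleR) (simp add: divide_inverse mult.commute)
      moreover have "norm (of_real (norm z) - a) < d / 2"
        using cmod_le[of "of_real (norm z) - a"] r nR a by simp
      then have "norm (of_real (norm z) - a) / norm z < d / 2 / norm z"
        using n by (intro divide_strict_right_mono) auto
      moreover have "d / 2 / norm z < d / 2 / (1 / 2)"
        using n d by (intro divide_strict_left_mono) auto
      ultimately have "norm (1 - fst (z /\<^sub>R norm z)) < d" by simp
      with n1 show ?thesis by simp
    qed
    then have sub: "B \<subseteq> ball 0 1 \<inter> (\<lambda>z::C2. z /\<^sub>R norm z) -` {z. norm (1 - fst z) < d}"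
      by auto
    have "ball 0 1 \<inter> (\<lambda>z::C2. z /\<^sub>R norm z) -` {z. norm (1 - fst z) < d} \<in> sets borel"
      using measurable_sets[OF radial_measurable cap_borel, of d] by auto
    then have "ennreal (d\<^sup>2 / 64) \<le> emeasure lborel (ball 0 1 \<inter> (\<lambda>z::C2. z /\<^sub>R norm z) -` {z. norm (1 - fst z) < d})"
      unfolding eB[symmetric] by (intro emeasure_mono sub) auto
    then have "ennreal (d\<^sup>2 / 64) / ennreal V \<le> emeasure (sigma_bd Unit_Ball) {z. norm (1 - fst z) < d}"
      using emeasure_sphere_measure[OF cap_borel, of d] eV by (simp add: divide_right_mono_ennreal)
    then show ?thesis using V by (simp add: divide_ennreal)
  qed
  then show ?thesis using V by (intro exI[of _ "1 / 64 / V"]) auto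
qed

text \<open>Only the cap of radius d = 1 - x is kept: there the kernel is at least (3 d)^(-2), and
  the cap has measure at least c d^2. Together they give the exponent 2 - 2 p.\<close>

lemma hardy_mean_ball_kernel_ge:
  assumes "1 < p"
  shows "\<exists>c>0. \<forall>x\<in>{0<..<1}. ennreal (c * (1 - x) powr (2 - 2 * p)) \<le> hardy_mean Unit_Ball p (slice_kernel Unit_Ball x)"
proof -
  obtain c where c: "c > 0" and cap: "\<And>d. d \<in> {0<..1} \<Longrightarrow>
      ennreal (c * d\<^sup>2) \<le> emeasure (sigma_bd Unit_Ball) {z. norm (1 - fst z) < d}"
    using emeasure_sphere_cap_ge by blast
  have "ennreal (c * 3 powr (- 2 * p) * (1 - x) powr (2 - 2 * p)) \<le> hardy_mean Unit_Ball p (slice_kernel Unit_Ball x)"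
    if x: "x \<in> {0<..<1}" for x
  proof -
    define d where "d = 1 - x"
    have d: "0 < d" "d \<le> 1" using x by (auto simp: d_def)
    let ?A = "{z::C2. norm (1 - fst z) < d}"
    have A: "?A \<in> sets (sigma_bd Unit_Ball)" unfolding sets_sigma_bd by (rule cap_borel)
    have "ennreal (c * 3 powr (- 2 * p) * (1 - x) powr (2 - 2 * p)) = ennreal ((3 * d) powr (- 2 * p)) * ennreal (c * d\<^sup>2)"
    proof -
      have "(1 - x) powr (2 - 2 * p) = d powr (- 2 * p) * d\<^sup>2"
        using d powr_add[of d "- 2 * p" 2] by (simp add: d_def)
      moreover have "(3 * d) powr (- 2 * p) = 3 powr (- 2 * p) * d powr (- 2 * p)"
        using d by (subst powr_mult) auto
      ultimately show ?thesis using c d by (simp add: ennreal_mult[symmetric])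
    qed
    also have "\<dots> \<le> ennreal ((3 * d) powr (- 2 * p)) * emeasure (sigma_bd Unit_Ball) ?A"
      using d cap by (intro mult_left_mono) auto
    also have "\<dots> = (\<integral>\<^sup>+z. ennreal ((3 * d) powr (- 2 * p)) * indicator ?A z \<partial>sigma_bd Unit_Ball)"
      by (rule nn_integral_cmult_indicator[OF A, symmetric])
    \<comment> \<open>The radius r = x is admissible in the supremum and close enough to 1: the
      parameter becomes x^2, and 1 - x^2 <= 2 d, so the denominator on the cap is at most d + 2
      d.\<close>
    also have "\<dots> \<le> (\<integral>\<^sup>+z. ennreal (norm (slice_kernel Unit_Ball x (x *\<^sub>R z)) powr p) \<partial>sigma_bd Unit_Ball)"
    proof (rule nn_integral_mono_AE, use AE_sigma_bd_fst in eventually_elim)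
      fix z :: C2 assume z: "norm (fst z) \<le> 1"
      show "ennreal ((3 * d) powr (- 2 * p)) * indicator ?A z \<le> ennreal (norm (slice_kernel Unit_Ball x (x *\<^sub>R z)) powr p)"
      proof (cases "z \<in> ?A")
        case True
        have xx: "0 \<le> x * x" "x * x < 1" using x mult_strict_mono[of x 1 x 1] by auto
        have "1 - of_real (x * x) * fst z = (1 - fst z) + of_real (1 - x * x) * fst z"
          by (simp add: algebra_simps)
        then have "norm (1 - of_real (x * x) * fst z) \<le> norm (1 - fst z) + norm (of_real (1 - x * x) * fst z)"
          by (metis norm_triangle_ineq)
        also have "norm (of_real (1 - x * x) * fst z) \<le> 1 - x * x"
          unfolding norm_mult norm_of_real using xx z by (simp add: mult_left_le)
        also have "1 - x * x \<le> 2 * d"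
          using x zero_le_square[of "1 - x"] by (simp add: d_def algebra_simps)
        finally have u: "norm (1 - of_real (x * x) * fst z) \<le> 3 * d" using True by simp
        have pos: "norm (1 - of_real (x * x) * fst z) > 0"
          using norm_one_minus_ge_dist[OF z, of "x * x"] xx by linarith
        have "(3 * d) powr (- 2 * p) \<le> norm (1 - of_real (x * x) * fst z) powr (- 2 * p)"
          using u pos assms by (intro powr_mono2') auto
        also have "\<dots> = norm (slice_kernel Unit_Ball x (x *\<^sub>R z)) powr p"
        proof -
          have "norm (slice_kernel Unit_Ball x (x *\<^sub>R z)) = 1 / norm (1 - of_real (x * x) * fst z) ^ 2"
            unfolding slice_kernel_scale
            by (simp add: slice_kernel_def slice_exponent_def norm_divide norm_power)
          also have "\<dots> = norm (1 - of_real (x * x) * fst z) powr (- 2)"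
            using pos by (simp add: powr_minus_divide)
          finally show ?thesis by (simp only: powr_powr)
        qed
        finally show ?thesis using True by (simp add: ennreal_leI)
      qed auto
    qed
    also have "\<dots> \<le> hardy_mean Unit_Ball p (slice_kernel Unit_Ball x)"
      unfolding hardy_mean_def using x by (intro SUP_upper) auto
    finally show ?thesis .
  qed
  then show ?thesis using c by (intro exI[of _ "c * 3 powr (- 2 * p)"]) auto
qed

text \<open>The exponent is q = 1 / p' on the bidisc, read off from the definition, and q = 2 / p'
  on the ball, where the lower bound for the norm is inverted.\<close>

lemma kernel_weight_le:
  assumes "1 < p"
  shows "\<exists>C\<ge>0. \<exists>q>0. \<forall>x\<in>{0<..<1}. kernel_weight \<Omega> p x \<le> C * (1 - x) powr q"
proof (cases \<Omega>)
  case Bidisc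
  have "kernel_weight \<Omega> p x \<le> 2 powr (1 / conj_exponent p) * (1 - x) powr (1 / conj_exponent p)"
    if "x \<in> {0<..<1}" for x
  proof -
    have "1 - x\<^sup>2 \<le> 2 * (1 - x)" using zero_le_power2[of "1 - x"] by (simp add: power2_eq_square algebra_simps)
    moreover have "0 \<le> 1 - x\<^sup>2" using that by (simp add: power_le_one)
    ultimately have "(1 - x\<^sup>2) powr (1 / conj_exponent p) \<le> (2 * (1 - x)) powr (1 / conj_exponent p)"
      using assms by (intro powr_mono2) (auto simp: conj_exponent_def)
    also have "\<dots> = 2 powr (1 / conj_exponent p) * (1 - x) powr (1 / conj_exponent p)"
      using that by (subst powr_mult) auto
    finally show ?thesis using Bidisc by (simp add: kernel_weight_def)
  qed
  moreover have "1 / conj_exponent p > 0" using assms by (simp add: conj_exponent_def)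
  ultimately show ?thesis by (intro exI[of _ "2 powr (1 / conj_exponent p)"] conjI exI[of _ "1 / conj_exponent p"]) auto
next
  case Unit_Ball
  obtain c where c: "c > 0" and le: "\<And>x. x \<in> {0<..<1} \<Longrightarrow>
     ennreal (c * (1 - x) powr (2 - 2 * p)) \<le> hardy_mean Unit_Ball p (slice_kernel Unit_Ball x)"
    using hardy_mean_ball_kernel_ge[OF assms] by blast
  have "kernel_weight \<Omega> p x \<le> c powr (- 1 / p) * (1 - x) powr (2 * (p - 1) / p)"
    if x: "x \<in> {0<..<1}" for x
  proof -
    have fin: "hardy_mean Unit_Ball p (slice_kernel Unit_Ball x) < top"
      using hardy_mean_slice_kernel_finite[of p x Unit_Ball] x assms by simp
    have "c * (1 - x) powr (2 - 2 * p) \<le> enn2real (hardy_mean Unit_Ball p (slice_kernel Unit_Ball x))"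
      using enn2real_mono[OF le[OF x] fin] c by simp
    then have "(c * (1 - x) powr (2 - 2 * p)) powr (1 / p) \<le> hardy_norm Unit_Ball p (slice_kernel Unit_Ball x)"
      unfolding hardy_norm_def using assms c by (intro powr_mono2) auto
    moreover have pos: "(c * (1 - x) powr (2 - 2 * p)) powr (1 / p) > 0" using c x by simp
    ultimately have "kernel_weight \<Omega> p x \<le> 1 / (c * (1 - x) powr (2 - 2 * p)) powr (1 / p)"
      using Unit_Ball by (simp add: kernel_weight_def kernel_slice frac_le)
    also have "\<dots> = (c * (1 - x) powr (2 - 2 * p)) powr (- 1 / p)"
      using powr_minus_divide[of _ "1 / p"] by simp
    also have "\<dots> = c powr (- 1 / p) * (1 - x) powr ((2 - 2 * p) * (- 1 / p))"
      using c by (simp only: powr_mult powr_powr)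
    also have "(2 - 2 * p) * (- 1 / p) = 2 * (p - 1) / p" using assms by (simp add: field_simps)
    finally show ?thesis .
  qed
  moreover have "2 * (p - 1) / p > 0" using assms by simp
  ultimately show ?thesis using c
    by (intro exI[of _ "c powr (- 1 / p)"] conjI exI[of _ "2 * (p - 1) / p"]) auto
qed

lemma kernel_weight_small:
  assumes "1 < p" "0 < e"
  shows "\<exists>t\<in>{0<..<1}. \<forall>x\<in>{t<..<1}. kernel_weight \<Omega> p x < e"
proof -
  obtain C q where C: "C \<ge> 0" "q > 0" and le: "\<And>x. x \<in> {0<..<1} \<Longrightarrow> kernel_weight \<Omega> p x \<le> C * (1 - x) powr q"
    using kernel_weight_le[OF assms(1)] by blast
  \<comment> \<open>Dividing by C + 1 covers C = 0 and makes the final inequality strict.\<close>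
  define u where "u = (e / (C + 1)) powr (1 / q)"
  have u: "u > 0" "u powr q = e / (C + 1)"
    using C assms(2) by (simp_all add: u_def powr_powr)
  show ?thesis
  proof (rule bexI[of _ "max (1 - u) (1 / 2)"], rule ballI)
    fix x assume "x \<in> {max (1 - u) (1 / 2)<..<1}"
    then have x: "x \<in> {0<..<1}" "1 - x \<le> u" by auto
    have "kernel_weight \<Omega> p x \<le> C * (1 - x) powr q" using x(1) by (rule le)
    also have "\<dots> \<le> C * u powr q"
      using x C by (intro mult_left_mono powr_mono2) auto
    also have "\<dots> < e" using C assms(2) unfolding u(2) by (simp add: field_simps)
    finally show "kernel_weight \<Omega> p x < e" .
  qed (use u in auto)
qed

section \<open>Almost disjoint sums\<close>

lemma le_suminf_powr:
  fixes u :: "nat \<Rightarrow> real"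
  assumes "0 < p" "\<And>j. 0 \<le> u j" "summable (\<lambda>j. u j powr p)"
  shows "u j \<le> (\<Sum>i. u i powr p) powr (1 / p)"
proof -
  have "u j powr p \<le> (\<Sum>i. u i powr p)"
    using sum_le_suminf[OF assms(3), of "{j}"] by simp
  then have "(u j powr p) powr (1 / p) \<le> (\<Sum>i. u i powr p) powr (1 / p)"
    using assms by (intro powr_mono2) auto
  then show ?thesis using assms by (simp add: powr_powr)
qed

text \<open>
  At most two of the weights are 1 and the others are \<open>2\<^sup>j\<close>, so that their reciprocals add up to
  at most 4.
\<close>

lemma suminf_le_of_weighted:
  fixes a :: "nat \<Rightarrow> real"
  assumes "0 \<le> \<tau>" and nn: "\<And>j. 0 \<le> a j"
    and le: "\<And>j. a j * (if P (j div 2) then 1 else 2 ^ j) \<le> \<tau>"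
    and P: "\<And>m n. P m \<Longrightarrow> P n \<Longrightarrow> m = n"
  shows "summable a" "(\<Sum>j. a j) \<le> 4 * \<tau>"
proof -
  define J where "J = {j. P (j div 2)}"
  have J: "finite J \<and> card J \<le> 2"
  proof (cases "\<exists>m. P m")
    case True
    then obtain m where "P m" by blast
    then have "J \<subseteq> {2 * m, 2 * m + 1}"
    proof (intro subsetI)
      fix j assume "j \<in> J"
      then have "j div 2 = m" using P \<open>P m\<close> by (auto simp: J_def)
      then show "j \<in> {2 * m, 2 * m + 1}" by auto
    qed
    moreover have "card {2 * m, 2 * m + 1} = 2" by simp
    ultimately show ?thesis by (metis card_mono finite.emptyI finite_insert finite_subset)
  qed (simp add: J_def)
  let ?b = "\<lambda>j. (if j \<in> J then \<tau> else 0) + \<tau> * (1 / 2) ^ j"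
  have "(\<lambda>j. if j \<in> J then \<tau> else 0) sums (\<Sum>j\<in>J. \<tau>)"
    using J by (intro sums_If_finite_set) auto
  moreover have "(\<lambda>j. \<tau> * (1 / 2) ^ j) sums (\<tau> * 2)"
    using geometric_sums[of "1 / 2 :: real"] by (intro sums_mult) simp
  ultimately have b: "?b sums ((\<Sum>j\<in>J. \<tau>) + \<tau> * 2)" by (rule sums_add)
  have ab: "a j \<le> ?b j" for j
  proof (cases "P (j div 2)")
    case True
    then have "a j \<le> \<tau>" using le[of j] by simp
    moreover have "0 \<le> \<tau> * (1 / 2) ^ j" using assms(1) by simp
    ultimately show ?thesis using True unfolding J_def by simp
  next
    case False
    then show ?thesis using le[of j] by (simp add: J_def power_one_over field_simps)
  qed
  show s: "summable a"
  proof (rule summable_comparison_test'[OF sums_summable[OF b], of 0])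
    show "norm (a j) \<le> ?b j" for j
      unfolding real_norm_def abs_of_nonneg[OF nn] by (rule ab)
  qed
  have "(\<Sum>j. a j) \<le> (\<Sum>j\<in>J. \<tau>) + \<tau> * 2"
    using suminf_le[OF ab s sums_summable[OF b]] sums_unique[OF b] by simp
  moreover have "real (card J) * \<tau> \<le> 2 * \<tau>"
    using J assms(1) by (intro mult_right_mono) auto
  ultimately show "(\<Sum>j. a j) \<le> 4 * \<tau>" by simp
qed

text \<open>Each weighted term is at most the l^p norm of all of them, so the previous lemma applies
  with that norm as \<open>\<tau>\<close>; an infinite right-hand side is trivial. The point is to
  replace the p-th power of a sum by a sum of p-th powers, which can be integrated term by
  term.\<close>

lemma suminf_powr_le_of_weighted:
  fixes a :: "nat \<Rightarrow> real"
  assumes "0 < p" and nn: "\<And>j. 0 \<le> a j"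
    and P: "\<And>m n. P m \<Longrightarrow> P n \<Longrightarrow> m = n"
  shows "ennreal ((\<Sum>j. a j) powr p)
    \<le> ennreal (4 powr p) * (\<Sum>j. ennreal ((a j * (if P (j div 2) then 1 else 2 ^ j)) powr p))"
proof -
  define w where "w j = a j * (if P (j div 2) then 1 else 2 ^ j)" for j
  have w: "0 \<le> w j" for j unfolding w_def using nn by simp
  have "ennreal ((\<Sum>j. a j) powr p) \<le> ennreal (4 powr p) * (\<Sum>j. ennreal (w j powr p))"
  proof (cases "(\<Sum>j. ennreal (w j powr p))")
    case top
    then show ?thesis by (simp add: ennreal_mult_top)
  next
    case (real t)
    have le: "w j \<le> t powr (1 / p)" for j
    proof -
      have "(\<Sum>i\<in>{j}. ennreal (w i powr p)) \<le> ennreal t"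
        unfolding real(2)[symmetric] by (rule sum_le_suminf) (auto intro: summableI)
      then have "w j powr p \<le> t" using real(1) by simp
      then have "(w j powr p) powr (1 / p) \<le> t powr (1 / p)" using assms(1) by (intro powr_mono2) auto
      then show ?thesis using assms(1) w[of j] by (simp add: powr_powr)
    qed
    have s: "summable a" "(\<Sum>j. a j) \<le> 4 * t powr (1 / p)"
      by (rule suminf_le_of_weighted[where P = P]; use nn P le in \<open>auto simp only: w_def powr_ge_zero\<close>)+
    have "(\<Sum>j. a j) powr p \<le> (4 * t powr (1 / p)) powr p"
      using s nn assms(1) by (intro powr_mono2 suminf_nonneg) auto
    also have "\<dots> = 4 powr p * t"
      using real(1) assms(1) powr_mult[of 4 "t powr (1 / p)" p] by (simp add: powr_powr)
    finally show ?thesis unfolding real(2) using real(1) by (simp add: ennreal_mult[symmetric] ennreal_leI)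
  qed
  then show ?thesis unfolding w_def .
qed

section \<open>Rapidly approaching pairs of points\<close>

text \<open>With h = 1 - y, the difference of the reciprocals is at most (y - x) / h^2. For exponent
  2 the remaining factor 1/A + 1/B is at most 2 / h; for exponent 1 the extra 2 / h is harmless
  because h <= 1. One bound thus serves both domains.\<close>

lemma slice_kernel_lipschitz:
  assumes "0 \<le> x" "x \<le> y" "y < 1" "norm (fst z) \<le> 1"
  shows "norm (slice_kernel \<Omega> x z - slice_kernel \<Omega> y z) \<le> 2 * (y - x) / (1 - y) ^ 3"
proof -
  define h where "h = 1 - y"
  define A where "A = 1 - of_real x * fst z"
  define B where "B = 1 - of_real y * fst z"
  have h: "0 < h" "h \<le> 1" using assms by (auto simp: h_def)
  have A: "h \<le> norm A" and B: "h \<le> norm B"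
    using norm_one_minus_ge_dist[of "fst z" x] norm_one_minus_ge_dist[of "fst z" y] assms
    by (auto simp: A_def B_def h_def)
  then have nz: "A \<noteq> 0" "B \<noteq> 0" using h by auto
  have iA: "norm (1 / A) \<le> 1 / h" and iB: "norm (1 / B) \<le> 1 / h"
    unfolding norm_divide norm_one using A B h by (auto intro!: frac_le)
  have "B - A = - (of_real (y - x) * fst z)" by (simp add: A_def B_def algebra_simps)
  then have BA: "norm (B - A) \<le> y - x"
    unfolding \<open>B - A = _\<close> norm_minus_cancel norm_mult norm_of_real using assms by (simp add: mult_left_le)
  have "1 / A - 1 / B = (B - A) * ((1 / A) * (1 / B))" using nz by (simp add: field_simps)
  then have "norm (1 / A - 1 / B) = norm (B - A) * (norm (1 / A) * norm (1 / B))"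
    by (simp only: norm_mult)
  also have "\<dots> \<le> (y - x) * (1 / h * (1 / h))"
    using BA iA iB h assms by (intro mult_mono) auto
  finally have diff: "norm (1 / A - 1 / B) \<le> (y - x) * (1 / h * (1 / h))" .
  have "norm ((1 / A) ^ k - (1 / B) ^ k) \<le> (y - x) * (1 / h * (1 / h)) * (2 / h)" if "k = 1 \<or> k = 2" for k :: nat
  proof (cases "k = 1")
    case True
    have "(y - x) * (1 / h * (1 / h)) * 1 \<le> (y - x) * (1 / h * (1 / h)) * (2 / h)"
      using h assms by (intro mult_left_mono) auto
    with True diff show ?thesis by simp
  next
    case False
    then have "(1 / A) ^ k - (1 / B) ^ k = (1 / A - 1 / B) * (1 / A + 1 / B)"
      using that by (simp add: power2_eq_square algebra_simps)
    moreover have "norm (1 / A + 1 / B) \<le> 2 / h"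
      using norm_triangle_ineq[of "1 / A" "1 / B"] iA iB by simp
    ultimately show ?thesis
      unfolding norm_mult using diff h assms by (simp only: norm_mult) (intro mult_mono; simp)
  qed
  moreover have "slice_exponent \<Omega> = 1 \<or> slice_exponent \<Omega> = 2"
    by (cases \<Omega>) (auto simp: slice_exponent_def)
  ultimately have "norm (slice_kernel \<Omega> x z - slice_kernel \<Omega> y z) \<le> (y - x) * (1 / h * (1 / h)) * (2 / h)"
    unfolding slice_kernel_def A_def[symmetric] B_def[symmetric] power_one_over[symmetric] by blast
  then show ?thesis by (simp add: h_def power3_eq_cube mult_ac)
qed

text \<open>x is fixed before y. Restricting y to 1 - y >= h = (1 - x) / 2 makes the Lipschitz
  constant depend on x alone, so y can then be moved towards x until the weighted difference is at
  most \<open>\<epsilon>\<close>.\<close>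

lemma exists_close_pair:
  assumes "1 < p" "0 < e" "0 < \<epsilon>" "t0 < 1"
  shows "\<exists>x y. 0 < x \<and> t0 < x \<and> x < y \<and> y < 1 \<and> kernel_weight \<Omega> p x \<le> e \<and> kernel_weight \<Omega> p y \<le> e \<and>
    (\<forall>z. norm (fst z) < 1 \<longrightarrow>
       kernel_weight \<Omega> p x * norm (slice_kernel \<Omega> x z - slice_kernel \<Omega> y z) \<le> \<epsilon>)"
proof -
  obtain t where t: "0 < t" "t < 1" and small: "\<And>x. t < x \<Longrightarrow> x < 1 \<Longrightarrow> kernel_weight \<Omega> p x < e"
    using kernel_weight_small[OF assms(1,2), of \<Omega>] by auto
  define x where "x = (max t t0 + 1) / 2"
  have x: "t < x" "t0 < x" "0 < x" "x < 1" using t assms by (auto simp: x_def)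
  define N where "N = kernel_weight \<Omega> p x"
  have N: "N > 0" unfolding N_def using x assms by (intro kernel_weight_pos) auto
  define h where "h = (1 - x) / 2"
  have h: "0 < h" using x by (simp add: h_def)
  define y where "y = x + min h (\<epsilon> * h ^ 3 / (2 * N))"
  have y: "x < y" "y \<le> x + h" "y - x \<le> \<epsilon> * h ^ 3 / (2 * N)"
    using h N assms(3) by (auto simp: y_def)
  have hy: "h \<le> 1 - y" using y(2) unfolding h_def by argo
  then have y1: "y < 1" using h by linarith
  have "N * norm (slice_kernel \<Omega> x z - slice_kernel \<Omega> y z) \<le> \<epsilon>" if "norm (fst z) < 1" for z
  proof -
    have "norm (slice_kernel \<Omega> x z - slice_kernel \<Omega> y z) \<le> 2 * (y - x) / (1 - y) ^ 3"
      using x y y1 that by (intro slice_kernel_lipschitz) auto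
    also have "\<dots> \<le> 2 * (\<epsilon> * h ^ 3 / (2 * N)) / h ^ 3"
      using y hy h by (intro frac_le mult_left_mono power_mono) auto
    also have "\<dots> = \<epsilon> / N" using h by simp
    finally show ?thesis using N by (simp add: field_simps)
  qed
  then show ?thesis
    using x y y1 small[of x] small[of y] by (intro exI[of _ x] exI[of _ y]) (auto simp: N_def)
qed

text \<open>\<open>d n\<close> and \<open>d (Suc n)\<close> are the outer and inner radius of shell
  n. \<open>weight\<close> makes the kernels of pair n tiny outside the outer cap, where |1 - r z
  z_1| >= d n / 2; \<open>cap\<close> bounds their contribution inside the inner cap by measure
  times the trivial supremum; \<open>close\<close> is what defeats the lower estimate. The factor
  4^(n+1) pays for the multipliers 2^j.\<close>

locale kernel_pairs =
  fixes \<Omega> :: domain2 and p :: real and d x y :: "nat \<Rightarrow> real"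
  assumes p: "1 < p"
    and d_pos: "0 < d n" and d_le_1: "d n \<le> 1" and d_Suc: "d (Suc n) \<le> d n"
    and x_pos: "0 < x n" and x_less_y: "x n < y n" and y_less_x: "y n < x (Suc n)" and y_less_1: "y n < 1"
    and weight: "z \<in> {x n, y n} \<Longrightarrow>
      4 ^ Suc n * kernel_weight \<Omega> p z * (2 / d n) ^ slice_exponent \<Omega> \<le> 1"
    and cap: "z \<in> {x n, y n} \<Longrightarrow>
      emeasure (sigma_bd \<Omega>) {\<zeta>. norm (1 - fst \<zeta>) < d (Suc n)}
        * ennreal ((4 ^ Suc n * kernel_weight \<Omega> p z * (1 / (1 - z)) ^ slice_exponent \<Omega>) powr p) \<le> 1"
    and close: "norm (fst \<zeta>) < 1 \<Longrightarrow>
      kernel_weight \<Omega> p (x n) * norm (slice_kernel \<Omega> (x n) \<zeta> - slice_kernel \<Omega> (y n) \<zeta>) \<le> 1 / Suc n"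

text \<open>Dependent choice on triples (d, x, y), starting from d = 1. \<open>P\<close> collects
  the conditions within one triple, \<open>Q\<close> those linking it to the next: the new radius is
  constrained by the old pair, and the new pair lies beyond the old one.\<close>

lemma kernel_pairs_exist:
  fixes \<Omega> :: domain2
  assumes p: "1 < p"
  shows "\<exists>d x y. kernel_pairs \<Omega> p d x y"
proof -
  let ?k = "slice_exponent \<Omega>"
  define P where "P n s = (case s of (d, x, y) \<Rightarrow> 0 < d \<and> d \<le> 1 \<and> 0 < x \<and> x < y \<and> y < 1 \<and>
    (\<forall>z\<in>{x, y}. 4 ^ Suc n * kernel_weight \<Omega> p z * (2 / d) ^ ?k \<le> 1) \<and>
    (\<forall>\<zeta>. norm (fst \<zeta>) < 1 \<longrightarrow>
       kernel_weight \<Omega> p x * norm (slice_kernel \<Omega> x \<zeta> - slice_kernel \<Omega> y \<zeta>) \<le> 1 / Suc n))"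
    for n and s :: "real \<times> real \<times> real"
  define Q where "Q n s s' = (case s of (d, x, y) \<Rightarrow> case s' of (d', x', y') \<Rightarrow> d' \<le> d \<and> y < x' \<and>
    (\<forall>z\<in>{x, y}. emeasure (sigma_bd \<Omega>) {\<zeta>. norm (1 - fst \<zeta>) < d'}
        * ennreal ((4 ^ Suc n * kernel_weight \<Omega> p z * (1 / (1 - z)) ^ ?k) powr p) \<le> 1))"
    for n and s s' :: "real \<times> real \<times> real"
  have ex: "\<exists>x y. t0 < x \<and> P n (d, x, y)" if "0 < d" "d \<le> 1" "t0 < 1" for n d t0
  proof -
    \<comment> \<open>The largest weight for which the condition on the outer cap holds.\<close>
    define e where "e = 1 / (4 ^ Suc n * (2 / d) ^ ?k)"
    have "e > 0" using that by (simp add: e_def)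
    from exists_close_pair[OF p this, of "1 / Suc n" t0 \<Omega>] that
    obtain x y where xy: "0 < x" "t0 < x" "x < y" "y < 1" "kernel_weight \<Omega> p x \<le> e" "kernel_weight \<Omega> p y \<le> e"
      "\<forall>z. norm (fst z) < 1 \<longrightarrow>
       kernel_weight \<Omega> p x * norm (slice_kernel \<Omega> x z - slice_kernel \<Omega> y z) \<le> 1 / Suc n" by auto
    have "4 ^ Suc n * w * (2 / d) ^ ?k \<le> 1" if "w \<le> e" for w
    proof -
      have "w * (4 ^ Suc n * (2 / d) ^ ?k) \<le> 1"
        using that \<open>0 < d\<close> unfolding e_def by (subst (asm) pos_le_divide_eq) auto
      then show ?thesis by (simp only: mult_ac)
    qed
    then have "P n (d, x, y)" using xy that unfolding P_def by simp
    with xy show ?thesis by blast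
  qed
  have "\<exists>f. \<forall>n. P n (f n) \<and> Q n (f n) (f (Suc n))"
  proof (rule dependent_nat_choice)
    show "\<exists>s. P 0 s" using ex[of 1 0 0] by auto
    fix s n assume "P n s"
    obtain d x y where s: "s = (d, x, y)" by (cases s)
    from \<open>P n s\<close> have d: "0 < d" "d \<le> 1" and xy: "0 < x" "x < y" "y < 1" by (auto simp: s P_def)
    define K where "K z = (4 ^ Suc n * kernel_weight \<Omega> p z * (1 / (1 - z)) ^ ?k) powr p" for z
    \<comment> \<open>One bound for both nodes; L + 1 is used below so that the reciprocal exists
      even when L = 0.\<close>
    define L where "L = K x + K y"
    have KL: "0 \<le> K z" "K z \<le> L" if "z \<in> {x, y}" for z using that by (auto simp: L_def K_def)
    then have L: "0 \<le> L" by force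
    obtain d' where d': "d' > 0" and em: "emeasure (sigma_bd \<Omega>) {\<zeta>. norm (1 - fst \<zeta>) < d'} < ennreal (1 / (L + 1))"
      using emeasure_cap_small[of "1 / (L + 1)" \<Omega>] L by auto
    have m: "0 < min d d'" "min d d' \<le> 1" using d d' by linarith+
    obtain x' y' where xy': "y < x'" "P (Suc n) (min d d', x', y')"
      using ex[OF m, of y "Suc n"] xy by blast
    have "emeasure (sigma_bd \<Omega>) {\<zeta>. norm (1 - fst \<zeta>) < min d d'} * ennreal (K z) \<le> 1" if z: "z \<in> {x, y}" for z
    proof -
      have "emeasure (sigma_bd \<Omega>) {\<zeta>. norm (1 - fst \<zeta>) < min d d'} \<le> emeasure (sigma_bd \<Omega>) {\<zeta>. norm (1 - fst \<zeta>) < d'}"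
        by (intro emeasure_mono) (auto simp only: sets_sigma_bd cap_borel)
      also note em
      finally have "emeasure (sigma_bd \<Omega>) {\<zeta>. norm (1 - fst \<zeta>) < min d d'} * ennreal (K z)
          \<le> ennreal (1 / (L + 1)) * ennreal (L + 1)"
        using KL[OF z] by (intro mult_mono ennreal_leI) auto
      also have "\<dots> = 1" using L by (subst ennreal_mult[symmetric]) auto
      finally show ?thesis .
    qed
    then have "Q n s (min d d', x', y')" using xy' unfolding s Q_def K_def by auto
    with xy' show "\<exists>s'. P (Suc n) s' \<and> Q n s s'" by blast
  qed
  then obtain f where f: "\<And>n. P n (f n)" "\<And>n. Q n (f n) (f (Suc n))" by blast
  have "kernel_pairs \<Omega> p (\<lambda>n. fst (f n)) (\<lambda>n. fst (snd (f n))) (\<lambda>n. snd (snd (f n)))"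
    using p f unfolding P_def Q_def kernel_pairs_def by (auto simp: case_prod_beta)
  then show ?thesis by blast
qed

section \<open>The upper estimate\<close>

text \<open>Both domains project into the unit disc under z -> z_1, so holomorphy of everything
  built from these kernels is a one-variable question.\<close>

lemma holomorphic2_on_fst:
  assumes G: "\<And>w. norm w < 1 \<Longrightarrow> \<exists>D. (G has_field_derivative D) (at w)"
    and f: "f = (\<lambda>z. G (fst z))"
  shows "holomorphic2_on f (region \<Omega>)"
  unfolding holomorphic2_on_def
proof
  fix z assume "z \<in> region \<Omega>"
  then have "norm (fst z) < 1"
    using norm_fst_le[of "fst z" "snd z"] by (cases \<Omega>) auto
  then obtain D where "(G has_derivative (\<lambda>h. D * h)) (at (fst z))"
    using G by (auto simp: has_field_derivative_def)
  from has_derivative_compose[OF has_derivative_fst[OF has_derivative_ident] this]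
  have "(f has_derivative (\<lambda>h. D * fst h + 0 * snd h)) (at z)"
    unfolding f by simp
  then show "\<exists>A B. (f has_derivative (\<lambda>h. A * fst h + B * snd h)) (at z)" by blast
qed

section \<open>Interleaved nodes, shells, and the weighted integral estimate\<close>

context kernel_pairs
begin

text \<open>Pair n occupies the indices 2 n and 2 n + 1, so \<open>j div 2\<close> recovers the
  pair, and with it the shell, of index j.\<close>

definition node :: "nat \<Rightarrow> real" where
  "node j = (if even j then x (j div 2) else y (j div 2))"

definition point :: "nat \<Rightarrow> C2" where
  "point j = (of_real (node j), 0)"

definition wt :: "nat \<Rightarrow> real" where
  "wt j = kernel_weight \<Omega> p (node j)"

definition size_at :: "nat \<Rightarrow> C2 \<Rightarrow> real" where
  "size_at j z = wt j * norm (slice_kernel \<Omega> (node j) z)"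

text \<open>Membership is tested at the boundary point z, not at its dilate r z, so the shells do
  not move with r.\<close>

definition shell :: "nat \<Rightarrow> C2 set" where
  "shell n = {z. d (Suc n) \<le> norm (1 - fst z) \<and> norm (1 - fst z) < d n}"

lemma node_mem: "node j \<in> {x (j div 2), y (j div 2)}"
  by (simp add: node_def)

lemma node_pos: "0 < node j" and node_less_1: "node j < 1"
  using x_pos[of "j div 2"] x_less_y[of "j div 2"] y_less_1[of "j div 2"] by (auto simp: node_def)

lemma node_strict_mono: "strict_mono node"
proof (rule strict_monoI_Suc)
  fix j show "node j < node (Suc j)"
    using x_less_y[of "j div 2"] y_less_x[of "j div 2"] by (cases "even j") (auto simp: node_def)
qed

lemma inj_point: "inj point"
  using strict_mono_imp_inj_on[OF node_strict_mono] by (auto simp: inj_def point_def)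

lemma point_region: "point j \<in> region \<Omega>"
  using node_pos[of j] node_less_1[of j] by (cases \<Omega>) (auto simp: point_def norm_Pair)

lemma wt_pos: "0 < wt j"
  unfolding wt_def using p node_pos node_less_1 by (intro kernel_weight_pos) auto

lemma size_at_nonneg: "0 \<le> size_at j z"
  using wt_pos[of j] by (simp add: size_at_def)

lemma norm_normalized_kernel: "norm (normalized_kernel \<Omega> p (point j) z) = size_at j z"
  using wt_pos[of j] by (simp add: point_def normalized_kernel_slice size_at_def norm_mult flip: wt_def)

text \<open>From j <= 2 (j div 2) + 1: the factor 4^(n+1) of the locale dominates the multiplier 2^j
  for both members of pair n.\<close>

lemma two_power_le: "(2::real) ^ j \<le> 4 ^ Suc (j div 2)"
proof -
  have "(2::real) ^ j \<le> 2 ^ (2 * Suc (j div 2))" by (intro power_increasing) auto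
  then show ?thesis by (simp only: power_mult) simp
qed

lemma weight_shell: "2 ^ j * wt j * (2 / d (j div 2)) ^ slice_exponent \<Omega> \<le> 1"
proof -
  have "2 ^ j * wt j * (2 / d (j div 2)) ^ slice_exponent \<Omega>
      \<le> 4 ^ Suc (j div 2) * wt j * (2 / d (j div 2)) ^ slice_exponent \<Omega>"
    using two_power_le[of j] wt_pos[of j] d_pos[of "j div 2"] by (intro mult_right_mono) auto
  also have "\<dots> \<le> 1" unfolding wt_def using weight[OF node_mem] .
  finally show ?thesis .
qed

text \<open>As d <= 1, the factor (2 / d)^k is at least 1, so the condition on the outer cap already
  forces geometric decay of the weights. This makes kernel series with bounded coefficients
  converge.\<close>

lemma wt_le: "wt j \<le> (1 / 2) ^ j"
proof -
  have "1 \<le> (2 / d (j div 2)) ^ slice_exponent \<Omega>"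
    using d_pos[of "j div 2"] d_le_1[of "j div 2"] by (intro one_le_power) simp
  then have "2 ^ j * wt j * 1 \<le> 2 ^ j * wt j * (2 / d (j div 2)) ^ slice_exponent \<Omega>"
    using wt_pos[of j] by (intro mult_left_mono) auto
  then have "2 ^ j * wt j \<le> 1" using weight_shell[of j] by linarith
  then show ?thesis by (simp add: power_one_over field_simps)
qed

lemma shell_disjoint:
  assumes "z \<in> shell m" "z \<in> shell n"
  shows "m = n"
proof -
  have "decseq d" using d_Suc by (rule decseq_SucI)
  have "\<not> (z \<in> shell i \<and> z \<in> shell k)" if "i < k" for i k
    using decseqD[OF \<open>decseq d\<close>, of "Suc i" k] that by (auto simp: shell_def)
  with assms show ?thesis by (metis linorder_neqE_nat)
qed

lemma shell_measurable: "shell n \<in> sets borel"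
proof -
  have "shell n = {z. norm (1 - fst z) < d n} - {z. norm (1 - fst z) < d (Suc n)}"
    by (auto simp: shell_def)
  then show ?thesis using cap_borel by auto
qed

text \<open>The three summands belong to the three positions of z: on the shell the multiplier is 1;
  outside the outer cap the scaled kernel is at most 1; inside the inner cap it is at most its
  supremum times 4^(n+1). Passing from r z to z uses r x <= x.\<close>

lemma scaled_size_le:
  assumes z: "norm (fst z) \<le> 1" and r: "r \<in> {0..<1}"
  shows "(size_at j (r *\<^sub>R z) * (if z \<in> shell (j div 2) then 1 else 2 ^ j)) powr p
    \<le> size_at j (r *\<^sub>R z) powr p + 1 +
      (4 ^ Suc (j div 2) * wt j * (1 / (1 - node j)) ^ slice_exponent \<Omega>) powr p
        * indicator {\<zeta>. norm (1 - fst \<zeta>) < d (Suc (j div 2))} z"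
proof -
  let ?K = "4 ^ Suc (j div 2) * wt j * (1 / (1 - node j)) ^ slice_exponent \<Omega>"
  have x: "0 < node j" "node j < 1" by (rule node_pos node_less_1)+
  have "r * node j \<le> node j" using r x by (intro mult_left_le_one_le) auto
  moreover have "0 \<le> r * node j" using r x by simp
  ultimately have rx: "0 \<le> r * node j" "r * node j \<le> node j" "r * node j \<le> 1" using x by linarith+
  consider "z \<in> shell (j div 2)" | "norm (1 - fst z) \<ge> d (j div 2)" "z \<notin> shell (j div 2)"
    | "norm (1 - fst z) < d (Suc (j div 2))" "z \<notin> shell (j div 2)"
    by (force simp: shell_def)
  then show ?thesis
  proof cases
    case 1
    then show ?thesis by simp
  next
    case 2
    have "norm (slice_kernel \<Omega> (r * node j) z) \<le> (1 / (d (j div 2) / 2)) ^ slice_exponent \<Omega>"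
      using norm_one_minus_ge_half[OF z rx(1,3)] 2 rx z d_pos[of "j div 2"]
      by (intro slice_kernel_le) auto
    then have "wt j * norm (slice_kernel \<Omega> (r * node j) z) * 2 ^ j \<le> wt j * (2 / d (j div 2)) ^ slice_exponent \<Omega> * 2 ^ j"
      using wt_pos[of j] by (intro mult_right_mono mult_left_mono) auto
    also have "\<dots> \<le> 1" using weight_shell[of j] by (simp only: mult_ac)
    finally have "size_at j (r *\<^sub>R z) * 2 ^ j \<le> 1" by (simp add: size_at_def slice_kernel_scale)
    then have "(size_at j (r *\<^sub>R z) * 2 ^ j) powr p \<le> 1"
      using p size_at_nonneg by (intro powr_le1) auto
    with 2 show ?thesis by (simp add: add_increasing add_increasing2)
  next
    case 3
    have "norm (slice_kernel \<Omega> (r * node j) z) \<le> (1 / (1 - node j)) ^ slice_exponent \<Omega>"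
      using order_trans[OF diff_left_mono[OF rx(2)] norm_one_minus_ge_dist[OF z rx(1,3)]] rx z x
      by (intro slice_kernel_le) auto
    then have "wt j * norm (slice_kernel \<Omega> (r * node j) z) * 2 ^ j \<le> wt j * (1 / (1 - node j)) ^ slice_exponent \<Omega> * 4 ^ Suc (j div 2)"
      using wt_pos[of j] two_power_le[of j] x by (intro mult_mono mult_left_mono) auto
    also have "\<dots> = ?K" by (simp only: mult_ac)
    finally have "size_at j (r *\<^sub>R z) * 2 ^ j \<le> ?K" by (simp add: size_at_def slice_kernel_scale)
    then have "(size_at j (r *\<^sub>R z) * 2 ^ j) powr p \<le> ?K powr p"
      using p size_at_nonneg by (intro powr_mono2) auto
    with 3 show ?thesis by (simp add: add_increasing)
  qed
qed

lemma size_at_scale_measurable: "(\<lambda>z. size_at j (r *\<^sub>R z)) \<in> borel_measurable (sigma_bd \<Omega>)"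
proof -
  have "(\<lambda>z. size_at j (r *\<^sub>R z)) \<in> borel_measurable borel"
    unfolding size_at_def slice_kernel_scale by measurable
  then show ?thesis by (simp cong: measurable_cong_sets add: sets_sigma_bd measurable_cong_sets[OF sets_sigma_bd refl])
qed

text \<open>The bound is M + 2: M for the unscaled kernel, 1 for the total mass of the boundary
  measure, and 1 for the inner cap by \<open>cap\<close>.\<close>

lemma weighted_integral_le:
  "\<exists>M\<ge>0. \<forall>j. \<forall>r\<in>{0..<1}.
    (\<integral>\<^sup>+z. ennreal ((size_at j (r *\<^sub>R z) * (if z \<in> shell (j div 2) then 1 else 2 ^ j)) powr p) \<partial>sigma_bd \<Omega>) \<le> ennreal M"
proof -
  obtain M where M: "M \<ge> 0" and le: "\<And>x r. x \<in> {0<..<1} \<Longrightarrow> r \<in> {0..<1} \<Longrightarrow>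
    (\<integral>\<^sup>+z. ennreal ((kernel_weight \<Omega> p x * norm (slice_kernel \<Omega> x (r *\<^sub>R z))) powr p) \<partial>sigma_bd \<Omega>) \<le> ennreal M"
    using normalized_slice_kernel_bounded[OF p, of \<Omega>] by blast
  have "(\<integral>\<^sup>+z. ennreal ((size_at j (r *\<^sub>R z) * (if z \<in> shell (j div 2) then 1 else 2 ^ j)) powr p) \<partial>sigma_bd \<Omega>) \<le> ennreal (M + 2)"
    if r: "r \<in> {0..<1}" for j r
  proof -
    define K where "K = (4 ^ Suc (j div 2) * wt j * (1 / (1 - node j)) ^ slice_exponent \<Omega>) powr p"
    define A where "A = {\<zeta>::C2. norm (1 - fst \<zeta>) < d (Suc (j div 2))}"
    have A: "A \<in> sets (sigma_bd \<Omega>)" unfolding A_def sets_sigma_bd by (rule cap_borel)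
    have m: "(\<lambda>z. ennreal (size_at j (r *\<^sub>R z) powr p)) \<in> borel_measurable (sigma_bd \<Omega>)"
      using size_at_scale_measurable by measurable
    have "(\<integral>\<^sup>+z. ennreal ((size_at j (r *\<^sub>R z) * (if z \<in> shell (j div 2) then 1 else 2 ^ j)) powr p) \<partial>sigma_bd \<Omega>)
      \<le> (\<integral>\<^sup>+z. (ennreal (size_at j (r *\<^sub>R z) powr p) + 1) + ennreal K * indicator A z \<partial>sigma_bd \<Omega>)"
    proof (rule nn_integral_mono_AE, use AE_sigma_bd_fst in eventually_elim)
      fix z :: C2 assume z: "norm (fst z) \<le> 1"
      have "ennreal ((size_at j (r *\<^sub>R z) * (if z \<in> shell (j div 2) then 1 else 2 ^ j)) powr p)
        \<le> ennreal (size_at j (r *\<^sub>R z) powr p + 1 + K * indicator A z)"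
        unfolding K_def A_def by (rule ennreal_leI[OF scaled_size_le[OF z r]])
      also have "\<dots> = (ennreal (size_at j (r *\<^sub>R z) powr p) + 1) + ennreal K * indicator A z"
        by (simp add: K_def ennreal_mult ennreal_indicator)
      finally show "ennreal ((size_at j (r *\<^sub>R z) * (if z \<in> shell (j div 2) then 1 else 2 ^ j)) powr p)
        \<le> (ennreal (size_at j (r *\<^sub>R z) powr p) + 1) + ennreal K * indicator A z" .
    qed
    also have "\<dots> = (\<integral>\<^sup>+z. ennreal (size_at j (r *\<^sub>R z) powr p) + 1 \<partial>sigma_bd \<Omega>) + (\<integral>\<^sup>+z. ennreal K * indicator A z \<partial>sigma_bd \<Omega>)"
      using m A by (intro nn_integral_add) auto
    also have "(\<integral>\<^sup>+z. ennreal (size_at j (r *\<^sub>R z) powr p) + 1 \<partial>sigma_bd \<Omega>)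
        = (\<integral>\<^sup>+z. ennreal (size_at j (r *\<^sub>R z) powr p) \<partial>sigma_bd \<Omega>) + (\<integral>\<^sup>+z. 1 \<partial>sigma_bd \<Omega>)"
      using m by (intro nn_integral_add) auto
    also have "(\<integral>\<^sup>+z. 1 \<partial>sigma_bd \<Omega>) = 1" by (simp add: emeasure_sigma_bd_UNIV)
    also have "(\<integral>\<^sup>+z. ennreal K * indicator A z \<partial>sigma_bd \<Omega>) = ennreal K * emeasure (sigma_bd \<Omega>) A"
      by (rule nn_integral_cmult_indicator[OF A])
    also have "\<dots> \<le> 1"
      using cap[OF node_mem[of j]] unfolding K_def A_def wt_def by (simp only: mult.commute)
    also have "(\<integral>\<^sup>+z. ennreal (size_at j (r *\<^sub>R z) powr p) \<partial>sigma_bd \<Omega>) \<le> ennreal M"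
      unfolding size_at_def wt_def using node_pos node_less_1 r by (intro le) auto
    finally have "(\<integral>\<^sup>+z. ennreal ((size_at j (r *\<^sub>R z) * (if z \<in> shell (j div 2) then 1 else 2 ^ j)) powr p) \<partial>sigma_bd \<Omega>)
      \<le> ennreal M + 1 + 1" by (simp add: add_mono)
    also have "\<dots> = ennreal (M + 2)" using M by (simp add: add.assoc one_add_one ennreal_plus flip: ennreal_numeral)
    finally show ?thesis .
  qed
  then show ?thesis using M by (intro exI[of _ "M + 2"]) auto
qed

text \<open>The multipliers turn the p-th power of the series into a series of p-th powers,
  integrated term by term. Stating it for any f dominated by the series of moduli lets it serve both
  the full sum and its remainders. M + 1 in place of M keeps the constant positive.\<close>

lemma hardy_mean_le_lp:
  "\<exists>C>0. \<forall>u f. (\<forall>j. 0 \<le> u j) \<longrightarrow> summable (\<lambda>j. u j powr p) \<longrightarrow>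
     (\<forall>z. norm (fst z) < 1 \<longrightarrow> norm (f z) \<le> (\<Sum>j. u j * size_at j z)) \<longrightarrow>
     hardy_mean \<Omega> p f \<le> ennreal (C * (\<Sum>j. u j powr p))"
proof -
  obtain M where M: "M \<ge> 0" and le: "\<And>j r. r \<in> {0..<1} \<Longrightarrow>
    (\<integral>\<^sup>+z. ennreal ((size_at j (r *\<^sub>R z) * (if z \<in> shell (j div 2) then 1 else 2 ^ j)) powr p) \<partial>sigma_bd \<Omega>) \<le> ennreal M"
    using weighted_integral_le by blast
  have "hardy_mean \<Omega> p f \<le> ennreal (4 powr p * (M + 1) * (\<Sum>j. u j powr p))"
    if u: "\<And>j. 0 \<le> u j" "summable (\<lambda>j. u j powr p)"
      and f: "\<And>z. norm (fst z) < 1 \<Longrightarrow> norm (f z) \<le> (\<Sum>j. u j * size_at j z)" for u f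
    unfolding hardy_mean_def
  proof (rule SUP_least)
    fix r :: real assume r: "r \<in> {0..<1}"
    define H where "H j z = ennreal ((size_at j (r *\<^sub>R z) * (if z \<in> shell (j div 2) then 1 else 2 ^ j)) powr p)" for j z
    have H: "H j \<in> borel_measurable (sigma_bd \<Omega>)" for j
    proof -
      have [measurable]: "shell (j div 2) \<in> sets (sigma_bd \<Omega>)"
        unfolding sets_sigma_bd by (rule shell_measurable)
      note [measurable] = size_at_scale_measurable
      show ?thesis unfolding H_def by measurable
    qed
    have "(\<integral>\<^sup>+ z. ennreal (norm (f (r *\<^sub>R z)) powr p) \<partial>sigma_bd \<Omega>)
       \<le> (\<integral>\<^sup>+ z. ennreal (4 powr p) * (\<Sum>j. ennreal (u j powr p) * H j z) \<partial>sigma_bd \<Omega>)"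
    proof (rule nn_integral_mono_AE, use AE_sigma_bd_fst in eventually_elim)
      fix z :: C2 assume z: "norm (fst z) \<le> 1"
      have "r * norm (fst z) \<le> r * 1" using r z by (intro mult_left_mono) auto
      then have "norm (fst (r *\<^sub>R z)) < 1" using r by simp
      from f[OF this] have "ennreal (norm (f (r *\<^sub>R z)) powr p) \<le> ennreal ((\<Sum>j. u j * size_at j (r *\<^sub>R z)) powr p)"
        using p by (intro ennreal_leI powr_mono2) auto
      also have "\<dots> \<le> ennreal (4 powr p) *
          (\<Sum>j. ennreal ((u j * size_at j (r *\<^sub>R z) * (if z \<in> shell (j div 2) then 1 else 2 ^ j)) powr p))"
        using p u size_at_nonneg shell_disjoint by (intro suminf_powr_le_of_weighted) auto
      also have "(\<lambda>j. ennreal ((u j * size_at j (r *\<^sub>R z) * (if z \<in> shell (j div 2) then 1 else 2 ^ j)) powr p))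
          = (\<lambda>j. ennreal (u j powr p) * H j z)"
      proof
        fix j
        show "ennreal ((u j * size_at j (r *\<^sub>R z) * (if z \<in> shell (j div 2) then 1 else 2 ^ j)) powr p)
          = ennreal (u j powr p) * H j z"
          unfolding H_def mult.assoc using u(1)[of j] size_at_nonneg[of j "r *\<^sub>R z"]
          by (subst powr_mult) (auto simp: ennreal_mult)
      qed
      finally show "ennreal (norm (f (r *\<^sub>R z)) powr p) \<le> ennreal (4 powr p) * (\<Sum>j. ennreal (u j powr p) * H j z)" .
    qed
    also have "\<dots> = ennreal (4 powr p) * (\<integral>\<^sup>+ z. (\<Sum>j. ennreal (u j powr p) * H j z) \<partial>sigma_bd \<Omega>)"
      using H by (intro nn_integral_cmult borel_measurable_suminf) auto
    also have "(\<integral>\<^sup>+ z. (\<Sum>j. ennreal (u j powr p) * H j z) \<partial>sigma_bd \<Omega>)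
        = (\<Sum>j. \<integral>\<^sup>+ z. ennreal (u j powr p) * H j z \<partial>sigma_bd \<Omega>)"
      using H by (intro nn_integral_suminf) auto
    also have "\<dots> \<le> (\<Sum>j. ennreal (u j powr p * (M + 1)))"
    proof (intro suminf_le summableI)
      fix j
      have "(\<integral>\<^sup>+ z. ennreal (u j powr p) * H j z \<partial>sigma_bd \<Omega>) = ennreal (u j powr p) * (\<integral>\<^sup>+ z. H j z \<partial>sigma_bd \<Omega>)"
        using H by (intro nn_integral_cmult)
      also have "\<dots> \<le> ennreal (u j powr p) * ennreal M"
        unfolding H_def using r by (intro mult_left_mono le) auto
      also have "\<dots> \<le> ennreal (u j powr p * (M + 1))"
        using M by (subst ennreal_mult[symmetric]) (auto intro!: ennreal_leI mult_left_mono)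
      finally show "(\<integral>\<^sup>+ z. ennreal (u j powr p) * H j z \<partial>sigma_bd \<Omega>) \<le> ennreal (u j powr p * (M + 1))" .
    qed
    also have "\<dots> = ennreal (\<Sum>j. u j powr p * (M + 1))"
      using M u by (intro suminf_ennreal2 summable_mult2) auto
    also have "(\<Sum>j. u j powr p * (M + 1)) = (\<Sum>j. u j powr p) * (M + 1)"
      using u by (intro suminf_mult2[symmetric])
    also have "ennreal (4 powr p) * ennreal ((\<Sum>j. u j powr p) * (M + 1)) = ennreal (4 powr p * (M + 1) * (\<Sum>j. u j powr p))"
      using M u by (subst ennreal_mult[symmetric]) (auto simp: suminf_nonneg mult_ac)
    finally show "(\<integral>\<^sup>+ z. ennreal (norm (f (r *\<^sub>R z)) powr p) \<partial>sigma_bd \<Omega>) \<le> ennreal (4 powr p * (M + 1) * (\<Sum>j. u j powr p))"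
      by (simp add: mult_left_mono)
  qed
  then show ?thesis using M by (intro exI[of _ "4 powr p * (M + 1)"]) auto
qed

end

section \<open>Kernel series\<close>

context kernel_pairs
begin

text \<open>An ordered pointwise sum. That it is also the unconditional sum in the Hardy norm is
  shown in \<open>hilbertian\<close>.\<close>

definition kernel_series :: "(nat \<Rightarrow> complex) \<Rightarrow> C2 \<Rightarrow> complex" where
  "kernel_series a z = (\<Sum>j. a j * normalized_kernel \<Omega> p (point j) z)"

lemma size_at_le:
  assumes "norm (fst z) \<le> \<rho>" "\<rho> < 1"
  shows "size_at j z \<le> (1 / 2) ^ j * (1 / (1 - \<rho>)) ^ slice_exponent \<Omega>"
proof -
  have "norm (of_real (node j) * fst z) \<le> norm (fst z)"
    using node_pos[of j] node_less_1[of j] by (simp add: norm_mult mult_left_le_one_le)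
  then have "1 - \<rho> \<le> norm (1 - of_real (node j) * fst z)"
    using norm_triangle_ineq2[of 1 "of_real (node j) * fst z"] assms by simp
  then have "norm (slice_kernel \<Omega> (node j) z) \<le> (1 / (1 - \<rho>)) ^ slice_exponent \<Omega>"
    using node_pos[of j] node_less_1[of j] assms by (intro slice_kernel_le) auto
  then show ?thesis
    unfolding size_at_def using wt_le[of j] by (intro mult_mono) auto
qed

lemma summable_size_at:
  assumes "norm (fst z) < 1" and u: "\<And>j. 0 \<le> u j" "\<And>j. u j \<le> U"
  shows "summable (\<lambda>j. u j * size_at j z)"
proof (rule summable_comparison_test'[of _ 0])
  show "summable (\<lambda>j. U * ((1 / 2) ^ j * (1 / (1 - norm (fst z))) ^ slice_exponent \<Omega>))"
    by (intro summable_mult summable_mult2 summable_geometric) simp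
  fix j
  have "0 \<le> U" using u[of 0] by linarith
  then show "norm (u j * size_at j z) \<le> U * ((1 / 2) ^ j * (1 / (1 - norm (fst z))) ^ slice_exponent \<Omega>)"
    using u[of j] size_at_nonneg[of j z] size_at_le[OF order_refl assms(1), of j]
    by (simp add: abs_mult mult_mono)
qed

text \<open>Weierstrass: on |w| <= r < 1 the terms are dominated by a geometric series. The terms do
  not depend on z_2, so they are differentiated along the slice z_2 = 0.\<close>

lemma holomorphic_kernel_series:
  assumes a: "\<And>j. norm (a j) \<le> U"
  shows "holomorphic2_on (kernel_series a) (region \<Omega>)"
proof -
  let ?k = "slice_exponent \<Omega>"
  define T where "T j w = a j * normalized_kernel \<Omega> p (point j) (w, 0)" for j w
  have T_eq: "T j = (\<lambda>w. a j * (of_real (wt j) * (1 / (1 - of_real (node j) * w) ^ ?k)))" for j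
    by (rule ext) (simp add: T_def point_def normalized_kernel_slice slice_kernel_def wt_def)
  have U: "0 \<le> U" using norm_ge_zero[of "a 0"] a[of 0] by linarith
  have der: "(T j has_field_derivative deriv (T j) w) (at w)" if "w \<in> ball 0 1" for j w
  proof -
    have "1 - of_real (node j) * w \<noteq> 0"
      using that node_pos[of j] node_less_1[of j] by (intro slice_kernel_denominator_nonzero) auto
    then have "T j field_differentiable (at w)"
      unfolding T_eq by (intro derivative_intros) auto
    then show ?thesis by (simp add: DERIV_deriv_iff_field_differentiable)
  qed
  have "\<exists>g g'. \<forall>w\<in>ball 0 1. ((\<lambda>j. T j w) sums g w) \<and> ((\<lambda>j. deriv (T j) w) sums g' w)
      \<and> (g has_field_derivative g' w) (at w)"
  proof (rule series_and_derivative_comparison_complex[OF open_ball der])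
    fix w :: complex assume w: "w \<in> ball 0 1"
    \<comment> \<open>Halfway to the unit circle, so that a whole disc around w stays in |v| <=
      r.\<close>
    define r where "r = (1 + norm w) / 2"
    have r: "r < 1" using w by (simp add: r_def)
    define h where "h j = complex_of_real (U * ((1 / 2) ^ j * (1 / (1 - r)) ^ ?k))" for j :: nat
    have "summable (\<lambda>j. U * ((1 / 2) ^ j * (1 / (1 - r)) ^ ?k))"
      by (intro summable_mult summable_mult2 summable_geometric) simp
    then have "summable h" unfolding h_def by (rule summable_of_real)
    moreover have "range h \<subseteq> \<real>\<^sub>\<ge>\<^sub>0" using U r unfolding h_def
      by (intro image_subsetI) (simp only: nonneg_Reals_of_real_iff, simp)
    moreover have "norm (T j v) \<le> norm (h j)" if v: "v \<in> ball w (r - norm w)" for j v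
    proof -
      have "norm v \<le> r" using norm_triangle_ineq2[of v w] v by (simp add: dist_norm norm_minus_commute)
      then have "norm (a j) * size_at j (v, 0) \<le> U * ((1 / 2) ^ j * (1 / (1 - r)) ^ ?k)"
        using a size_at_le[of "(v, 0)" r j] r size_at_nonneg U by (intro mult_mono) auto
      moreover have "norm (h j) = U * ((1 / 2) ^ j * (1 / (1 - r)) ^ ?k)"
        unfolding h_def norm_of_real using U r by (intro abs_of_nonneg) auto
      ultimately show ?thesis
        by (simp add: T_def norm_mult norm_normalized_kernel)
    qed
    moreover have "0 < r - norm w" using w by (simp add: r_def field_simps)
    ultimately show "\<exists>d h. 0 < d \<and> summable h \<and> range h \<subseteq> \<real>\<^sub>\<ge>\<^sub>0 \<and>
        (\<forall>\<^sub>F n in sequentially. \<forall>y\<in>ball w d \<inter> ball 0 1. cmod (T n y) \<le> cmod (h n))"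
      by (intro exI[of _ "r - norm w"] exI[of _ h]) auto
  qed
  then obtain g g' where g: "\<And>w. w \<in> ball 0 1 \<Longrightarrow> (\<lambda>j. T j w) sums g w"
      "\<And>w. w \<in> ball 0 1 \<Longrightarrow> (g has_field_derivative g' w) (at w)" by blast
  show ?thesis
  proof (rule holomorphic2_on_fst)
    show "kernel_series a = (\<lambda>z. (\<Sum>j. T j (fst z)))"
      by (rule ext) (simp add: kernel_series_def T_def point_def normalized_kernel_slice slice_kernel_def)
    fix w :: complex assume "norm w < 1"
    then have w: "w \<in> ball 0 1" by simp
    have "((\<lambda>w. \<Sum>j. T j w) has_field_derivative g' w) (at w)"
      using g(2)[OF w] open_ball w by (rule has_field_derivative_transform_within_open) (simp add: g(1) sums_unique)
    then show "\<exists>D. ((\<lambda>w. \<Sum>j. T j w) has_field_derivative D) (at w)" by blast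
  qed
qed

lemma kernel_series_sums:
  assumes "norm (fst z) < 1" and a: "\<And>j. norm (a j) \<le> U"
  shows "(\<lambda>j. a j * normalized_kernel \<Omega> p (point j) z) sums kernel_series a z"
    and "norm (kernel_series a z) \<le> (\<Sum>j. norm (a j) * size_at j z)"
proof -
  have s: "summable (\<lambda>j. norm (a j * normalized_kernel \<Omega> p (point j) z))"
    unfolding norm_mult norm_normalized_kernel by (rule summable_size_at[OF assms(1) norm_ge_zero a])
  show "(\<lambda>j. a j * normalized_kernel \<Omega> p (point j) z) sums kernel_series a z"
    unfolding kernel_series_def by (rule summable_sums[OF summable_norm_cancel[OF s]])
  show "norm (kernel_series a z) \<le> (\<Sum>j. norm (a j) * size_at j z)"
    using summable_norm[OF s] unfolding kernel_series_def norm_mult norm_normalized_kernel .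
qed

section \<open>Unconditional convergence and the Hilbertian bound\<close>

lemma bij_betw_point_preimage:
  assumes "F \<subseteq> range point"
  shows "bij_betw point {j. point j \<in> F} F"
  unfolding bij_betw_def
proof
  show "inj_on point {j. point j \<in> F}"
    using inj_point by (rule inj_on_subset) simp
  show "point ` {j. point j \<in> F} = F" using assms by blast
qed

text \<open>Passes from sums over sets of points to series over indices. It holds at every z, since
  only finitely many terms are nonzero.\<close>

lemma finite_sum_eq_kernel_series:
  assumes F: "finite F" "F \<subseteq> range point"
  shows "(\<lambda>z. \<Sum>b\<in>F. c b * normalized_kernel \<Omega> p b z)
    = kernel_series (\<lambda>j. if point j \<in> F then c (point j) else 0)"
proof
  fix z
  define J where "J = {j. point j \<in> F}"
  have bij: "bij_betw point J F"
    unfolding J_def by (rule bij_betw_point_preimage[OF F(2)])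
  then have J: "finite J" using F bij_betw_finite by blast
  have "(\<lambda>j. if j \<in> J then c (point j) * normalized_kernel \<Omega> p (point j) z else 0)
      sums (\<Sum>j\<in>J. c (point j) * normalized_kernel \<Omega> p (point j) z)"
    by (rule sums_If_finite_set[OF J])
  also have "(\<lambda>j. if j \<in> J then c (point j) * normalized_kernel \<Omega> p (point j) z else 0)
      = (\<lambda>j. (if point j \<in> F then c (point j) else 0) * normalized_kernel \<Omega> p (point j) z)"
    by (auto simp: J_def)
  finally have "kernel_series (\<lambda>j. if point j \<in> F then c (point j) else 0) z
      = (\<Sum>j\<in>J. c (point j) * normalized_kernel \<Omega> p (point j) z)"
    unfolding kernel_series_def by (rule sums_unique[symmetric])
  also have "\<dots> = (\<Sum>b\<in>F. c b * normalized_kernel \<Omega> p b z)"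
    by (rule sum.reindex_bij_betw[OF bij])
  finally show "(\<Sum>b\<in>F. c b * normalized_kernel \<Omega> p b z)
    = kernel_series (\<lambda>j. if point j \<in> F then c (point j) else 0) z" by simp
qed

text \<open>The same estimate is used twice: on the full series for the norm bound, and on the
  remainder after a finite set F of points. The remainder has coefficients vanishing on F, so its
  norm is controlled by the l^p tail, which tends to 0 along the finite subsets.\<close>

lemma hilbertian: "p_hilbertian (hardy_space \<Omega> p) (hardy_norm \<Omega> p) p (range point) (normalized_kernel \<Omega> p)"
proof -
  obtain C where C: "C > 0" and mean: "\<And>u f. (\<And>j. 0 \<le> u j) \<Longrightarrow> summable (\<lambda>j. u j powr p) \<Longrightarrow>
     (\<And>z. norm (fst z) < 1 \<Longrightarrow> norm (f z) \<le> (\<Sum>j. u j * size_at j z)) \<Longrightarrow>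
     hardy_mean \<Omega> p f \<le> ennreal (C * (\<Sum>j. u j powr p))"
    using hardy_mean_le_lp by blast
  show ?thesis
    unfolding p_hilbertian_def
  proof (intro exI[of _ "C powr (1 / p)"] conjI ballI)
    show "0 < C powr (1 / p)" using C by simp
    fix c :: "C2 \<Rightarrow> complex" assume c: "c \<in> lp_space p (range point)"
    define a where "a j = c (point j)" for j
    define T where "T = (\<Sum>\<^sub>\<infinity>b\<in>range point. norm (c b) powr p)"
    have so: "(\<lambda>b. norm (c b) powr p) summable_on range point"
      using c by (simp add: lp_space_def)
    then have so': "(\<lambda>j. norm (a j) powr p) summable_on UNIV"
      using inj_point by (subst (asm) summable_on_reindex) (auto simp: o_def a_def)
    then have sa: "summable (\<lambda>j. norm (a j) powr p)" by (rule summable_on_imp_summable)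
    have "T = infsum (\<lambda>j. norm (a j) powr p) UNIV"
      unfolding T_def using inj_point by (subst infsum_reindex) (auto simp: o_def a_def)
    then have T: "(\<lambda>j. norm (a j) powr p) sums T"
      using has_sum_imp_sums[OF has_sum_infsum[OF so']] by simp
    define U where "U = (\<Sum>j. norm (a j) powr p) powr (1 / p)"
    have U: "norm (a j) \<le> U" for j
      unfolding U_def using p sa by (intro le_suminf_powr[of p "\<lambda>j. norm (a j)"]) auto
    have T0: "0 \<le> T" unfolding T_def by (rule infsum_nonneg) simp
    let ?f = "kernel_series a"
    have mf: "hardy_mean \<Omega> p ?f \<le> ennreal (C * T)"
      unfolding sums_unique[OF T]
      by (rule mean[OF norm_ge_zero sa]) (rule kernel_series_sums(2)[OF _ U])
    have fH: "?f \<in> hardy_space \<Omega> p"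
      using holomorphic_kernel_series[OF U] le_less_trans[OF mf ennreal_less_top]
      by (simp add: hardy_space_def)
    have "hardy_norm \<Omega> p ?f \<le> (C * T) powr (1 / p)"
      using mf p C T0 by (intro hardy_norm_le) auto
    also have "\<dots> = C powr (1 / p) * lp_norm p (range point) c"
      using C T0 by (simp add: powr_mult lp_norm_def T_def)
    finally have nf: "hardy_norm \<Omega> p ?f \<le> C powr (1 / p) * lp_norm p (range point) c" .
    have tail: "hardy_norm \<Omega> p (\<lambda>z. (\<Sum>b\<in>F. c b * normalized_kernel \<Omega> p b z) - ?f z)
        \<le> (C * (T - (\<Sum>b\<in>F. norm (c b) powr p))) powr (1 / p) \<and> 0 \<le> T - (\<Sum>b\<in>F. norm (c b) powr p)"
      if F: "finite F" "F \<subseteq> range point" for F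
    proof -
      define J where "J = {j. point j \<in> F}"
      have bij: "bij_betw point J F"
        unfolding J_def by (rule bij_betw_point_preimage[OF F(2)])
      then have J: "finite J" using F bij_betw_finite by blast
      define u where "u j = (if j \<in> J then 0 else norm (a j))" for j
      have "(\<lambda>j. if j \<in> J then norm (a j) powr p else 0) sums (\<Sum>j\<in>J. norm (a j) powr p)"
        by (rule sums_If_finite_set[OF J])
      moreover have "(\<Sum>j\<in>J. norm (a j) powr p) = (\<Sum>b\<in>F. norm (c b) powr p)"
        unfolding a_def by (rule sum.reindex_bij_betw[OF bij])
      moreover have "(\<lambda>j. norm (a j) powr p - (if j \<in> J then norm (a j) powr p else 0)) = (\<lambda>j. u j powr p)"
        by (auto simp: u_def)
      ultimately have u: "(\<lambda>j. u j powr p) sums (T - (\<Sum>b\<in>F. norm (c b) powr p))"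
        using sums_diff[OF T, of "\<lambda>j. if j \<in> J then norm (a j) powr p else 0"] by simp
      have nn: "0 \<le> T - (\<Sum>b\<in>F. norm (c b) powr p)"
        unfolding sums_unique[OF u] using sums_summable[OF u] by (rule suminf_nonneg) simp
      let ?g = "\<lambda>z. (\<Sum>b\<in>F. c b * normalized_kernel \<Omega> p b z) - ?f z"
      have "hardy_mean \<Omega> p ?g \<le> ennreal (C * (\<Sum>j. u j powr p))"
      proof (rule mean)
        show "0 \<le> u j" for j by (simp add: u_def)
        show "summable (\<lambda>j. u j powr p)" using u by (rule sums_summable)
        fix z :: C2 assume z: "norm (fst z) < 1"
        let ?b = "\<lambda>j. if point j \<in> F then c (point j) else 0"
        \<comment> \<open>Coefficients of partial sum minus full sum: zero on F and -a off F, hence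
          of modulus u.\<close>
        let ?e = "\<lambda>j. ?b j - a j"
        have ne: "norm (?e j) = u j" for j by (simp add: u_def J_def a_def)
        have uU: "u j \<le> U" for j using U[of j] order_trans[OF norm_ge_zero U[of j]] by (simp add: u_def)
        have "norm (?b j) \<le> U" for j using U[of j] order_trans[OF norm_ge_zero U[of j]] by (simp add: a_def)
        from sums_diff[OF kernel_series_sums(1)[OF z this] kernel_series_sums(1)[OF z U]]
        have "(\<lambda>j. ?e j * normalized_kernel \<Omega> p (point j) z) sums (kernel_series ?b z - ?f z)"
          by (simp only: left_diff_distrib)
        then have "kernel_series ?e z = kernel_series ?b z - ?f z"
          unfolding kernel_series_def[of ?e] by (rule sums_unique[symmetric])
        moreover have "kernel_series ?b z = (\<Sum>b\<in>F. c b * normalized_kernel \<Omega> p b z)"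
          using fun_cong[OF finite_sum_eq_kernel_series[OF F, of c]] by simp
        moreover have "norm (kernel_series ?e z) \<le> (\<Sum>j. norm (?e j) * size_at j z)"
          using kernel_series_sums(2)[OF z, of ?e U] ne uU by simp
        ultimately show "norm ((\<Sum>b\<in>F. c b * normalized_kernel \<Omega> p b z) - ?f z) \<le> (\<Sum>j. u j * size_at j z)"
          unfolding ne by simp
      qed
      then have "hardy_norm \<Omega> p ?g \<le> (C * (T - (\<Sum>b\<in>F. norm (c b) powr p))) powr (1 / p)"
        using p C nn sums_unique[OF u] by (intro hardy_norm_le) auto
      with nn show ?thesis by blast
    qed
    have lim: "((\<lambda>F. \<Sum>b\<in>F. norm (c b) powr p) \<longlongrightarrow> T) (finite_subsets_at_top (range point))"
      using has_sum_infsum[OF so] unfolding has_sum_def T_def .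
    \<comment> \<open>The base tends to 0, where convergence of powers requires a positive exponent
      and an eventually nonnegative base; the second conjunct of \<open>tail\<close> supplies the
      latter.\<close>
    have "((\<lambda>F. (C * (T - (\<Sum>b\<in>F. norm (c b) powr p))) powr (1 / p)) \<longlongrightarrow> (C * (T - T)) powr (1 / p))
        (finite_subsets_at_top (range point))"
    proof (rule tendsto_powr')
      show "((\<lambda>F. C * (T - (\<Sum>b\<in>F. norm (c b) powr p))) \<longlongrightarrow> C * (T - T)) (finite_subsets_at_top (range point))"
        by (intro tendsto_mult tendsto_diff tendsto_const lim)
      have "\<forall>\<^sub>F F in finite_subsets_at_top (range point). 0 \<le> C * (T - (\<Sum>b\<in>F. norm (c b) powr p))"
        by (intro eventually_finite_subsets_at_top_weakI mult_nonneg_nonneg less_imp_le[OF C] conjunct2[OF tail])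
      then show "C * (T - T) \<noteq> 0 \<or> 0 < 1 / p \<and> (\<forall>\<^sub>F F in finite_subsets_at_top (range point). 0 \<le> C * (T - (\<Sum>b\<in>F. norm (c b) powr p)))"
        using p by simp
    qed (rule tendsto_const)
    then have lim0: "((\<lambda>F. (C * (T - (\<Sum>b\<in>F. norm (c b) powr p))) powr (1 / p)) \<longlongrightarrow> 0)
        (finite_subsets_at_top (range point))"
      by simp
    have "((\<lambda>F. hardy_norm \<Omega> p (\<lambda>z. (\<Sum>b\<in>F. c b * normalized_kernel \<Omega> p b z) - ?f z)) \<longlongrightarrow> 0)
        (finite_subsets_at_top (range point))"
    proof (rule tendsto_sandwich[OF _ _ tendsto_const lim0])
      show "\<forall>\<^sub>F F in finite_subsets_at_top (range point).
         hardy_norm \<Omega> p (\<lambda>z. (\<Sum>b\<in>F. c b * normalized_kernel \<Omega> p b z) - ?f z)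
         \<le> (C * (T - (\<Sum>b\<in>F. norm (c b) powr p))) powr (1 / p)"
        using tail by (intro eventually_finite_subsets_at_top_weakI) blast
    qed (auto simp: hardy_norm_def)
    with fH nf show "\<exists>f. has_sum_in (hardy_space \<Omega> p) (hardy_norm \<Omega> p) (\<lambda>a z. c a * normalized_kernel \<Omega> p a z) (range point) f
         \<and> hardy_norm \<Omega> p f \<le> C powr (1 / p) * lp_norm p (range point) c"
      unfolding has_sum_in_def by blast
  qed
qed

lemma normalized_kernel_in_hardy_space: "normalized_kernel \<Omega> p (point j) \<in> hardy_space \<Omega> p"
proof -
  let ?e = "\<lambda>i. if point i \<in> {point j} then 1 else (0::complex)"
  have e: "normalized_kernel \<Omega> p (point j) = kernel_series ?e"
    using finite_sum_eq_kernel_series[of "{point j}" "\<lambda>_. 1"] by simp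
  have "holomorphic2_on (normalized_kernel \<Omega> p (point j)) (region \<Omega>)"
    unfolding e by (rule holomorphic_kernel_series[of _ 1]) simp
  moreover have "hardy_mean \<Omega> p (normalized_kernel \<Omega> p (point j))
      \<le> ennreal ((wt j * (1 / (1 - node j)) ^ slice_exponent \<Omega>) powr p)"
  proof (rule hardy_mean_le)
    show "norm (normalized_kernel \<Omega> p (point j) z) \<le> wt j * (1 / (1 - node j)) ^ slice_exponent \<Omega>"
      if "norm (fst z) < 1" for z
      unfolding norm_normalized_kernel size_at_def
      using that node_pos[of j] node_less_1[of j] wt_pos[of j]
      by (intro mult_left_mono slice_kernel_bound) auto
  qed (use p wt_pos[of j] node_less_1[of j] in auto)
  then have "hardy_mean \<Omega> p (normalized_kernel \<Omega> p (point j)) < \<infinity>"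
    by (auto intro: le_less_trans)
  ultimately show ?thesis by (simp add: hardy_space_def)
qed

text \<open>A lower constant C would have to satisfy C <= 1/(n+1) for every n, by testing on the two
  kernels of pair n.\<close>

lemma not_besselian: "\<not> p_besselian (hardy_norm \<Omega> p) p (range point) (normalized_kernel \<Omega> p)"
proof
  assume "p_besselian (hardy_norm \<Omega> p) p (range point) (normalized_kernel \<Omega> p)"
  then obtain C where C: "C > 0" and bes: "\<And>c. finite {b\<in>range point. c b \<noteq> 0} \<Longrightarrow>
      C * lp_norm p (range point) c \<le> hardy_norm \<Omega> p (\<lambda>z. \<Sum>b\<in>{b\<in>range point. c b \<noteq> 0}. c b * normalized_kernel \<Omega> p b z)"
    unfolding p_besselian_def by blast
  have "C \<le> 1 / Suc n" for n
  proof -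
    define a where "a = point (2 * n)"
    define b where "b = point (2 * n + 1)"
    have ab: "a \<noteq> b" unfolding a_def b_def using inj_point by (auto dest: injD)
    \<comment> \<open>The ratio makes both kernels carry the same weight, leaving the difference
      that \<open>close\<close> controls. The coefficient 1 at a alone keeps the l^p norm at least
      1, whatever q is.\<close>
    define q where "q = wt (2 * n) / wt (2 * n + 1)"
    have q: "q > 0" unfolding q_def using wt_pos by simp
    define c where "c v = (if v = a then 1 else if v = b then - of_real q else (0::complex))" for v
    have supp: "{v\<in>range point. c v \<noteq> 0} = {a, b}"
      using q by (auto simp: c_def a_def b_def)
    have "(\<Sum>\<^sub>\<infinity>v\<in>range point. norm (c v) powr p) = (\<Sum>\<^sub>\<infinity>v\<in>{a, b}. norm (c v) powr p)"
      by (rule infsum_cong_neutral) (auto simp: c_def a_def b_def)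
    also have "\<dots> = 1 + q powr p" using ab q by (simp add: c_def)
    finally have "lp_norm p (range point) c = (1 + q powr p) powr (1 / p)"
      by (simp add: lp_norm_def)
    moreover have "1 powr (1 / p) \<le> (1 + q powr p) powr (1 / p)"
      using p by (intro powr_mono2) auto
    ultimately have lp: "1 \<le> lp_norm p (range point) c" by simp
    have "(\<Sum>v\<in>{a, b}. c v * normalized_kernel \<Omega> p v z)
        = of_real (wt (2 * n)) * (slice_kernel \<Omega> (x n) z - slice_kernel \<Omega> (y n) z)" for z
    proof -
      have "(\<Sum>v\<in>{a, b}. c v * normalized_kernel \<Omega> p v z)
          = normalized_kernel \<Omega> p a z - of_real q * normalized_kernel \<Omega> p b z"
        using ab by (simp add: c_def)
      also have "normalized_kernel \<Omega> p a z = of_real (wt (2 * n)) * slice_kernel \<Omega> (x n) z"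
        by (simp add: a_def point_def normalized_kernel_slice wt_def node_def)
      also have "of_real q * normalized_kernel \<Omega> p b z = of_real (wt (2 * n)) * slice_kernel \<Omega> (y n) z"
        using wt_pos[of "2 * n + 1"]
        by (simp add: b_def point_def normalized_kernel_slice node_def q_def flip: wt_def)
           (simp add: wt_def node_def)
      finally show ?thesis by (simp add: right_diff_distrib)
    qed
    then have "C * lp_norm p (range point) c
        \<le> hardy_norm \<Omega> p (\<lambda>z. of_real (wt (2 * n)) * (slice_kernel \<Omega> (x n) z - slice_kernel \<Omega> (y n) z))"
      using bes[of c] unfolding supp by simp
    also have "\<dots> \<le> ((1 / Suc n) powr p) powr (1 / p)"
    proof (intro hardy_norm_le hardy_mean_le)
      fix z :: C2 assume "norm (fst z) < 1"
      then show "norm (of_real (wt (2 * n)) * (slice_kernel \<Omega> (x n) z - slice_kernel \<Omega> (y n) z)) \<le> 1 / Suc n"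
        using close[of z n] wt_pos[of "2 * n"] by (simp add: norm_mult wt_def node_def)
    qed (use p in auto)
    also have "\<dots> = 1 / Suc n" using p by (simp add: powr_powr)
    finally have "C * lp_norm p (range point) c \<le> 1 / Suc n" .
    moreover have "C * 1 \<le> C * lp_norm p (range point) c" using C lp by (intro mult_left_mono) auto
    ultimately show ?thesis by simp
  qed
  moreover obtain n where "inverse (real (Suc n)) < C" using reals_Archimedean[OF C] by blast
  ultimately show False by (simp add: inverse_eq_divide not_less[symmetric])
qed

end

theorem theorem3p7:
  fixes \<Omega> :: domain2 and p :: real
  assumes "1 < p"
  shows "\<exists>s :: nat \<Rightarrow> C2. inj s \<and> range s \<subseteq> region \<Omega> \<and>
           (\<forall>a\<in>range s. normalized_kernel \<Omega> p a \<in> hardy_space \<Omega> p) \<and>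
           p_hilbertian (hardy_space \<Omega> p) (hardy_norm \<Omega> p) p (range s) (normalized_kernel \<Omega> p) \<and>
           \<not> p_riesz_sequence (hardy_space \<Omega> p) (hardy_norm \<Omega> p) p (range s) (normalized_kernel \<Omega> p)"
proof -
  obtain d x y where "kernel_pairs \<Omega> p d x y" using kernel_pairs_exist[OF assms] by blast
  then interpret kernel_pairs \<Omega> p d x y .
  show ?thesis
    using inj_point point_region normalized_kernel_in_hardy_space hilbertian not_besselian
    by (intro exI[of _ point]) (auto simp: p_riesz_sequence_def)
qed

end
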